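(* For dimension three, we have $\mathrm{OT}_3(n) = 2^{2^{\Theta(n)}}$.
   Context: A point set (or sequence of points) in $\mathbb{R}^3$ is in general position if no $4$ of its members lie on a common plane and, for each $1 \leq i \leq 3$, no two of its members share the same $i$-th coordinate. Let $P = (p_1,\dots,p_N)$ be a sequence of points in $\mathbb{R}^3$ in general position. For $i_1 < i_2 < i_3 < i_4$, the orientation of the $4$-tuple $(p_{i_1},p_{i_2},p_{i_3},p_{i_4})$ is the sign ($+1$ or $-1$) of the determinant of the unique linear map sending $p_{i_2}-p_{i_1},\, p_{i_3}-p_{i_1},\, p_{i_4}-p_{i_1}$ to the standard basis $e_1,e_2,e_3$; equivalently, it is the sign of the determinant of the $3\times 3$ matrix with columns $p_{i_2}-p_{i_1},\, p_{i_3}-p_{i_1},\, p_{i_4}-p_{i_1}$. A point sequence in $\mathbb{R}^3$ is order-type homogeneous if all of its $4$-tuples (taken with indices in increasing order) have the same orientation. $\mathrm{OT}_3(n)$ is the smallest integer $N$ such that every $N$-element point sequence in $\mathbb{R}^3$ in general position contains an $n$-element subsequence that is order-type homogeneous. Asymptotic notation: $f(n) = O(g(n))$ if $|f(n)| \leq c|g(n)|$ for some fixed constant $c$ and for all $n \geq 1$; $f(n) = \Omega(g(n))$ if $g(n) = O(f(n))$; and $f(n) = \Theta(g(n))$ if both $f(n) = O(g(n))$ and $f(n) = \Omega(g(n))$ hold.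
   Formalization: The identity is asserted for n ≥ 3 only: with bounds required for all n ≥ 1 it fails at n = 1, since OT_3(1) = 1 < 2^{2^x} for every x, and at n = 2, since OT_3(2) = 2 forces the exponent to be 0, which is not Ω(n). *)

theory Defs
  imports "HOL-Analysis.Analysis" "HOL-Library.Sublist" "HOL-Library.Ramsey"
begin

text \<open>
  Point sequences are lists, so that a subsequence is \<open>subseq\<close>. General position quantifies
  over indices rather than over the set of points, so a repeated point already violates it.
\<close>

definition general_position :: "(real^3) list \<Rightarrow> bool" where
  "general_position ps \<longleftrightarrow>
     (\<forall>i j k l. i < j \<and> j < k \<and> k < l \<and> l < length ps
        \<longrightarrow> \<not> coplanar {ps ! i, ps ! j, ps ! k, ps ! l}) \<and>
     (\<forall>c. \<forall>i j. i < j \<and> j < length ps \<longrightarrow> ps ! i $ c \<noteq> ps ! j $ c)"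

text \<open>\<open>vector\<close> lists the rows of a matrix; the transpose turns the three differences into columns.\<close>

definition orientation :: "real^3 \<Rightarrow> real^3 \<Rightarrow> real^3 \<Rightarrow> real^3 \<Rightarrow> real" where
  "orientation p q r s = sgn (det (transpose (vector [q - p, r - p, s - p])))"

text \<open>Agreement with the description by the linear map onto the standard basis:\<close>

lemma orientation_eq_linear_map:
  fixes f :: "real^3 \<Rightarrow> real^3"
  assumes "linear f" "f (q - p) = axis 1 1" "f (r - p) = axis 2 1" "f (s - p) = axis 3 1"
  shows "orientation p q r s = sgn (det (matrix f))"
proof -
  define M :: "real^3^3" where "M = transpose (vector [q - p, r - p, s - p])"
  have "column 1 M = q - p" "column 2 M = r - p" "column 3 M = s - p"
    by (simp_all add: M_def row_def vec_eq_iff)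
  then have M: "M *v axis 1 1 = q - p" "M *v axis 2 1 = r - p" "M *v axis 3 1 = s - p"
    by (simp_all add: matrix_vector_mult_basis)
  have "column i (matrix f ** M) = axis i 1" for i
  proof -
    have "column i (matrix f ** M) = f (M *v axis i 1)"
      using assms(1) by (simp add: matrix_vector_mult_basis[symmetric]
          matrix_vector_mul_assoc[symmetric] matrix_works)
    then show ?thesis
      using assms M exhaust_3[of i] by auto
  qed
  then have "matrix f ** M = mat 1"
    by (auto simp: column_def vec_eq_iff axis_def mat_def)
  then have "det (matrix f) * det M = 1"
    by (metis det_I det_mul)
  then have "sgn (det (matrix f)) * sgn (det M) = 1"
    by (metis sgn_mult sgn_one)
  then show ?thesis
    unfolding orientation_def M_def[symmetric] by (auto simp: sgn_if split: if_splits)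
qed

definition order_type_homogeneous :: "(real^3) list \<Rightarrow> bool" where
  "order_type_homogeneous ps \<longleftrightarrow>
     (\<exists>\<sigma>. \<forall>i j k l. i < j \<and> j < k \<and> k < l \<and> l < length ps
        \<longrightarrow> orientation (ps ! i) (ps ! j) (ps ! k) (ps ! l) = \<sigma>)"

definition OT3_bound :: "nat \<Rightarrow> nat \<Rightarrow> bool" where
  "OT3_bound n N \<longleftrightarrow>
     (\<forall>ps. length ps = N \<and> general_position ps
        \<longrightarrow> (\<exists>qs. subseq qs ps \<and> length qs = n \<and> order_type_homogeneous qs))"

definition OT3 :: "nat \<Rightarrow> nat" where
  "OT3 n = (LEAST N. OT3_bound n N)"

text \<open>\<open>OT3\<close> is well defined, by Ramsey's theorem for 4-element sets:\<close>

lemma OT3_bound_exists: "\<exists>N. OT3_bound n N"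
proof -
  obtain N :: nat where N: "partn_lst {..<N} [n, n, n] 4"
    using ramsey_full by blast
  have "\<exists>qs. subseq qs ps \<and> length qs = n \<and> order_type_homogeneous qs"
    if len: "length ps = N" for ps
  proof -
    define o4 where "o4 S = (let x = sorted_list_of_set S in
      orientation (ps ! (x ! 0)) (ps ! (x ! 1)) (ps ! (x ! 2)) (ps ! (x ! 3)))" for S
    define f where "f S = (if o4 S = 0 then 0 else if o4 S = 1 then 1 else 2::nat)" for S
    have "f \<in> nsets {..<N} 4 \<rightarrow> {..<3}"
      by (auto simp: f_def)
    then obtain c H where c: "c < 3" and "H \<in> nsets {..<N} ([n, n, n] ! c)"
        and fH: "f ` nsets H 4 \<subseteq> {c}"
      using N[THEN partn_lstE, of f 3] by (auto simp: numeral_3_eq_3)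
    moreover from c have "[n, n, n] ! c = n"
      by (auto simp: less_Suc_eq numeral_3_eq_3)
    ultimately have H: "H \<in> nsets {..<N} n" "f ` nsets H 4 \<subseteq> {c}"
      by auto
    have sgn3: "o4 S = 0 \<or> o4 S = 1 \<or> o4 S = -1" for S
      by (auto simp: o4_def orientation_def sgn_if Let_def)
    define hs where "hs = filter (\<lambda>i. i \<in> H) [0..<N]"
    define qs where "qs = map (\<lambda>i. ps ! i) hs"
    have seths: "set hs = H"
      using H by (auto simp: hs_def nsets_def)
    have sorted_hs: "sorted_wrt (<) hs"
      by (simp add: hs_def sorted_wrt_filter)
    have lenhs: "length hs = n"
      using seths sorted_hs H by (metis (mono_tags, lifting) distinct_card mem_Collect_eq nsets_def
          strict_sorted_iff)
    have "subseq qs (map (\<lambda>i. ps ! i) [0..<N])"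
      unfolding qs_def hs_def by (intro subseq_map subseq_filter_left)
    then have "subseq qs ps"
      using len map_nth by metis
    moreover have "order_type_homogeneous qs"
      unfolding order_type_homogeneous_def
    proof (intro exI allI impI)
      fix i j k l
      assume ijkl: "i < j \<and> j < k \<and> k < l \<and> l < length qs"
      have lt: "hs ! i < hs ! j" "hs ! j < hs ! k" "hs ! k < hs ! l"
        using ijkl sorted_hs by (auto simp: sorted_wrt_iff_nth_less qs_def)
      let ?S = "set [hs ! i, hs ! j, hs ! k, hs ! l]"
      have sl: "sorted_list_of_set ?S = [hs ! i, hs ! j, hs ! k, hs ! l]"
        using lt by (intro sorted_list_of_set.idem_if_sorted_distinct) auto
      have "?S \<in> nsets H 4"
        using lt ijkl seths by (auto simp: nsets_def qs_def)
      then have "f ?S = c"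
        using H by blast
      moreover have "o4 ?S = orientation (qs ! i) (qs ! j) (qs ! k) (qs ! l)"
        using ijkl unfolding o4_def sl by (simp add: qs_def)
      ultimately show "orientation (qs ! i) (qs ! j) (qs ! k) (qs ! l)
          = (if c = 0 then 0 else if c = 1 then 1 else -1)"
        using sgn3[of ?S] by (auto simp: f_def split: if_splits)
    qed
    ultimately show ?thesis
      using lenhs by (auto simp: qs_def)
  qed
  then show ?thesis
    unfolding OT3_bound_def by blast
qed

text \<open>
  Asymptotic notation with bounds that hold for all \<open>n \<ge> 1\<close>; the Landau symbols of the library
  only require them eventually.
\<close>

definition is_big_O :: "(nat \<Rightarrow> real) \<Rightarrow> (nat \<Rightarrow> real) \<Rightarrow> bool" where
  "is_big_O f g \<longleftrightarrow> (\<exists>c. \<forall>n\<ge>1. \<bar>f n\<bar> \<le> c * \<bar>g n\<bar>)"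

definition is_big_Omega :: "(nat \<Rightarrow> real) \<Rightarrow> (nat \<Rightarrow> real) \<Rightarrow> bool" where
  "is_big_Omega f g \<longleftrightarrow> is_big_O g f"

definition is_big_Theta :: "(nat \<Rightarrow> real) \<Rightarrow> (nat \<Rightarrow> real) \<Rightarrow> bool" where
  "is_big_Theta f g \<longleftrightarrow> is_big_O f g \<and> is_big_Omega f g"

end

theory Submission
  imports Defs
begin

text \<open>
  Upper bound. Repeated halving turns \<open>2 ^ poly m\<close> points into \<open>m\<close> points for which the orientation
  of a quadruple does not depend on its last point, which may hence be taken to be the last point of
  the sequence. Projecting from that point gives \<open>m\<close> points in the plane and orientations
  of triples, for which \<open>m = 2 ^ O(n)\<close> suffices by the two theorems of Erdos and Szekeres
  (monotone subsequences, cups and caps).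

  Lower bound. For vectors \<open>W\<^sub>i = (1, y\<^sub>i, z\<^sub>i)\<close> and \<open>t\<close> large, place at index \<open>a < 2 ^ M\<close> the point
  \<open>\<Sum>i. bit\<^sub>i(a) t ^ i W\<^sub>i\<close>. If \<open>\<delta>\<close> denotes the top bit where two indices differ, then \<open>a < b < c < d\<close>
  has the orientation of \<open>W\<close> at \<open>\<delta>(a,b), \<delta>(b,c), \<delta>(c,d)\<close> whenever these are distinct. View the
  indices of a homogeneous subsequence as the leaves of a binary tree. A Pluecker relation forbids
  an inner node other than the root to have two inner children, so half of the tree is a single path, and the
  levels on the path where it turns the same way form a cup or a cap of the points \<open>(y\<^sub>i, z\<^sub>i)\<close>.
  The same bit construction one dimension lower yields \<open>M = 2 ^ K\<close> points in the plane
  without cups and caps of more than \<open>K + 1\<close> points.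
\<close>

section \<open>Determinants and coplanarity\<close>

text \<open>Spelled out as a polynomial in the nine coordinates, so that the identities below are
  ring identities within reach of \<open>algebra_simps\<close>.\<close>

definition det3 :: "real^3 \<Rightarrow> real^3 \<Rightarrow> real^3 \<Rightarrow> real" where
  "det3 u v w = u $ 1 * (v $ 2 * w $ 3 - v $ 3 * w $ 2) - u $ 2 * (v $ 1 * w $ 3 - v $ 3 * w $ 1)
     + u $ 3 * (v $ 1 * w $ 2 - v $ 2 * w $ 1)"

lemma det_vector_3: "det (vector [u, v, w] :: real^3^3) = det3 u v w"
  by (simp add: det_3 det3_def algebra_simps)

lemma orientation_eq_sgn_det3: "orientation p q r s = sgn (det3 (q - p) (r - p) (s - p))"
  by (simp add: orientation_def det_vector_3)

lemma det3_scaleR: "det3 (a *\<^sub>R u) (b *\<^sub>R v) (c *\<^sub>R w) = a * b * c * det3 u v w"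
  by (simp add: det3_def algebra_simps)

text \<open>Moves the base point from the first to the last point, at the price of a sign. Once the
  last point is fixed, the orientation depends on the three vectors that lead from it to the other
  points.\<close>

lemma det3_from_last: "det3 (b - a) (c - a) (d - a) = - det3 (a - d) (b - d) (c - d)"
  by (simp add: det3_def algebra_simps)

text \<open>The affine hull of three points is \<open>a\<close> plus combinations of two vectors
  \<open>e\<close> and \<open>f\<close>, so the three differences are combinations of only two
  vectors.\<close>

lemma coplanar_imp_det3_eq_0:
  assumes "coplanar {p, q, r, s}"
  shows "det3 (q - p) (r - p) (s - p) = 0"
proof -
  obtain a b c where abc: "{p, q, r, s} \<subseteq> affine hull {a, b, c}"
    using assms by (auto simp: coplanar_def)
  define e f where "e = b - a" and "f = c - a"
  have "\<exists>x y. z = a + x *\<^sub>R e + y *\<^sub>R f" if "z \<in> {p, q, r, s}" for z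
  proof -
    have "z \<in> affine hull {a, b, c}"
      using abc that by blast
    then obtain t x y where "z = t *\<^sub>R a + x *\<^sub>R b + y *\<^sub>R c" "t + x + y = 1"
      unfolding affine_hull_3 by blast
    moreover from this have "t = 1 - x - y" by simp
    ultimately show ?thesis
      by (intro exI[of _ x] exI[of _ y]) (simp add: e_def f_def algebra_simps)
  qed
  then obtain x0 y0 x1 y1 x2 y2 x3 y3 where
    "p = a + x0 *\<^sub>R e + y0 *\<^sub>R f" "q = a + x1 *\<^sub>R e + y1 *\<^sub>R f"
    "r = a + x2 *\<^sub>R e + y2 *\<^sub>R f" "s = a + x3 *\<^sub>R e + y3 *\<^sub>R f"
    by (metis insertI1 insertI2)
  then have "q - p = (x1 - x0) *\<^sub>R e + (y1 - y0) *\<^sub>R f" "r - p = (x2 - x0) *\<^sub>R e + (y2 - y0) *\<^sub>R f"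
    "s - p = (x3 - x0) *\<^sub>R e + (y3 - y0) *\<^sub>R f"
    by (simp_all add: algebra_simps)
  moreover have "det3 (x1 *\<^sub>R e + y1 *\<^sub>R f) (x2 *\<^sub>R e + y2 *\<^sub>R f) (x3 *\<^sub>R e + y3 *\<^sub>R f) = 0" for x1 x2 x3 y1 y2 y3
    by (simp add: det3_def algebra_simps)
  ultimately show ?thesis by simp
qed

text \<open>A kernel vector of the matrix of differences is a linear relation between them. A point
  whose coefficient is nonzero lies in the affine hull of \<open>p\<close> and the other
  two.\<close>

lemma det3_eq_0_imp_coplanar:
  assumes "det3 (q - p) (r - p) (s - p) = 0"
  shows "coplanar {p, q, r, s}"
proof -
  define A :: "real^3^3" where "A = transpose (vector [q - p, r - p, s - p])"
  have "det A = 0"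
    using assms by (simp add: A_def det_vector_3)
  then obtain x where x: "x \<noteq> 0" "A *v x = 0"
    using invertible_det_nz[of A] matrix_left_invertible_ker[of A] invertible_left_inverse[of A] by blast
  have lin: "x $ 1 *\<^sub>R (q - p) + x $ 2 *\<^sub>R (r - p) + x $ 3 *\<^sub>R (s - p) = 0"
    using x(2) by (simp add: A_def vec_eq_iff matrix_vector_mult_def transpose_def sum_3 algebra_simps)
  have aux: "coplanar {p, u, v, w}"
    if "c \<noteq> 0" and uvw: "a *\<^sub>R (u - p) + b *\<^sub>R (v - p) + c *\<^sub>R (w - p) = 0" for a b c and u v w :: "real^3"
  proof -
    have "c *\<^sub>R w = (a + b + c) *\<^sub>R p - a *\<^sub>R u - b *\<^sub>R v"
      using uvw by (simp add: algebra_simps)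
    then have "(1 / c) *\<^sub>R c *\<^sub>R w = (1 / c) *\<^sub>R ((a + b + c) *\<^sub>R p - a *\<^sub>R u - b *\<^sub>R v)"
      by simp
    then have "w = (1 + a / c + b / c) *\<^sub>R p + (- a / c) *\<^sub>R u + (- b / c) *\<^sub>R v"
      using \<open>c \<noteq> 0\<close> by (simp add: algebra_simps)
    moreover have "1 + a / c + b / c + (- a / c) + (- b / c) = 1"
      using \<open>c \<noteq> 0\<close> by (simp add: field_simps)
    ultimately have "w \<in> affine hull {p, u, v}"
      unfolding affine_hull_3 by blast
    moreover have "{p, u, v} \<subseteq> affine hull {p, u, v}"
      by (rule hull_subset)
    ultimately show ?thesis
      unfolding coplanar_def by (intro exI[of _ p] exI[of _ u] exI[of _ v]) auto
  qed
  have "x $ 1 \<noteq> 0 \<or> x $ 2 \<noteq> 0 \<or> x $ 3 \<noteq> 0"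
    using x(1) by (auto simp: vec_eq_iff forall_3)
  then consider "x $ 1 \<noteq> 0" | "x $ 2 \<noteq> 0" | "x $ 3 \<noteq> 0" by blast
  then show ?thesis
  proof cases
    case 1
    then have "coplanar {p, r, s, q}"
      using aux[of "x $ 1" "x $ 2" r "x $ 3" s q] lin by (simp add: add_ac)
    then show ?thesis by (simp add: insert_commute)
  next
    case 2
    then have "coplanar {p, q, s, r}"
      using aux[of "x $ 2" "x $ 1" q "x $ 3" s r] lin by (simp add: add_ac)
    then show ?thesis by (simp add: insert_commute)
  next
    case 3
    then show ?thesis
      using aux[of "x $ 3" "x $ 1" q "x $ 2" r s] lin by simp
  qed
qed

lemma coplanar_iff_det3: "coplanar {p, q, r, s} \<longleftrightarrow> det3 (q - p) (r - p) (s - p) = 0"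
  using coplanar_imp_det3_eq_0 det3_eq_0_imp_coplanar by blast

text \<open>Twice the signed area of the triangle on the points with coordinates \<open>Y\<close>
  and \<open>Z\<close>. The coordinates are functions of the index, so that a whole family of points
  can be sheared or reflected at once.\<close>

definition det2 :: "('a \<Rightarrow> real) \<Rightarrow> ('a \<Rightarrow> real) \<Rightarrow> 'a \<Rightarrow> 'a \<Rightarrow> 'a \<Rightarrow> real" where
  "det2 Y Z a b c = (Y b - Y a) * (Z c - Z a) - (Y c - Y a) * (Z b - Z a)"

text \<open>If \<open>Y\<close> increases along \<open>a\<close>, \<open>b\<close>,
  \<open>c\<close>, \<open>d\<close>, all three multipliers are positive, so a common sign of the
  triples \<open>a b c\<close> and \<open>b c d\<close> passes to \<open>a b d\<close>. The mirrored
  identity below does the same for \<open>a c d\<close>.\<close>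

lemma det2_plucker_left:
  "det2 Y Z a b d * (Y c - Y b) = det2 Y Z a b c * (Y d - Y b) + det2 Y Z b c d * (Y b - Y a)"
  by (simp add: det2_def algebra_simps)

lemma det2_plucker_right:
  "det2 Y Z a c d * (Y c - Y b) = det2 Y Z b c d * (Y c - Y a) + det2 Y Z a b c * (Y d - Y c)"
  by (simp add: det2_def algebra_simps)

text \<open>When \<open>Y u\<close> and \<open>Y w\<close> lie below \<open>Y i\<close>, and
  \<open>Y i\<close> below \<open>Y k\<close>, the multipliers are positive and the three
  determinants cannot share a nonzero sign. This is what forbids branching in the tree of
  indices.\<close>

lemma det2_plucker_cross:
  "det2 Y Z u i k * (Y i - Y w) + det2 Y Z i w k * (Y i - Y u) + det2 Y Z u i w * (Y k - Y i) = 0"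
  by (simp add: det2_def algebra_simps)

text \<open>Shears preserve area; a suitable \<open>t\<close> makes the first coordinates
  distinct.\<close>

lemma det2_shear: "det2 (\<lambda>a. Y a + t * Z a) Z = det2 Y Z"
  by (simp add: det2_def fun_eq_iff algebra_simps)

lemma det2_uminus: "det2 (\<lambda>a. - Y a) Z a b c = - det2 Y Z a b c"
  by (simp add: det2_def algebra_simps)

lemma det2_swap12: "det2 Y Z b a c = - det2 Y Z a b c"
  by (simp add: det2_def algebra_simps)

lemma det2_rotate: "det2 Y Z c a b = det2 Y Z a b c"
  by (simp add: det2_def algebra_simps)

text \<open>Central projection onto the plane where the first coordinate is 1.\<close>

lemma det3_eq_det2:
  assumes "u a $ 1 \<noteq> 0" "u b $ 1 \<noteq> 0" "u c $ 1 \<noteq> 0"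
  shows "det3 (u a) (u b) (u c) =
    u a $ 1 * u b $ 1 * u c $ 1 * det2 (\<lambda>a. u a $ 2 / u a $ 1) (\<lambda>a. u a $ 3 / u a $ 1) a b c"
  using assms by (simp add: det3_def det2_def field_simps)

text \<open>As \<open>Y\<close> increases, the multipliers in the two Pluecker identities are
  positive. The second part argues with \<open>\<le> 0\<close>, so it also covers degenerate
  triples.\<close>

lemma det2_mono_transitive:
  assumes mono: "\<And>a b. a \<in> X \<Longrightarrow> b \<in> X \<Longrightarrow> a < b \<Longrightarrow> Y a < Y b"
  shows "\<forall>a\<in>X. \<forall>b\<in>X. \<forall>c\<in>X. \<forall>d\<in>X. a < b \<and> b < c \<and> c < d \<and> det2 Y Z a b c > 0 \<and> det2 Y Z b c d > 0 \<longrightarrow>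
     det2 Y Z a b d > 0 \<and> det2 Y Z a c d > 0"
    and "\<forall>a\<in>X. \<forall>b\<in>X. \<forall>c\<in>X. \<forall>d\<in>X. a < b \<and> b < c \<and> c < d \<and> \<not> det2 Y Z a b c > 0 \<and> \<not> det2 Y Z b c d > 0 \<longrightarrow>
     \<not> det2 Y Z a b d > 0 \<and> \<not> det2 Y Z a c d > 0"
proof -
  have *: "Y b - Y a > 0" "Y c - Y b > 0" "Y d - Y b > 0" "Y c - Y a > 0" "Y d - Y c > 0"
    if "a \<in> X" "b \<in> X" "c \<in> X" "d \<in> X" "a < b" "b < c" "c < d" for a b c d
    using mono[of a b] mono[of b c] mono[of c d] that by auto
  show "\<forall>a\<in>X. \<forall>b\<in>X. \<forall>c\<in>X. \<forall>d\<in>X. a < b \<and> b < c \<and> c < d \<and> det2 Y Z a b c > 0 \<and> det2 Y Z b c d > 0 \<longrightarrow>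
     det2 Y Z a b d > 0 \<and> det2 Y Z a c d > 0"
  proof (intro ballI impI)
    fix a b c d assume X: "a \<in> X" "b \<in> X" "c \<in> X" "d \<in> X"
      and h: "a < b \<and> b < c \<and> c < d \<and> det2 Y Z a b c > 0 \<and> det2 Y Z b c d > 0"
    note p = *[OF X] h
    have "det2 Y Z a b d * (Y c - Y b) > 0" "det2 Y Z a c d * (Y c - Y b) > 0"
      unfolding det2_plucker_left[of Y Z a b d c] det2_plucker_right[of Y Z a c d b]
      using p by (intro add_pos_pos mult_pos_pos; simp)+
    then show "det2 Y Z a b d > 0 \<and> det2 Y Z a c d > 0"
      using p by (metis zero_less_mult_pos2)
  qed
  show "\<forall>a\<in>X. \<forall>b\<in>X. \<forall>c\<in>X. \<forall>d\<in>X. a < b \<and> b < c \<and> c < d \<and> \<not> det2 Y Z a b c > 0 \<and> \<not> det2 Y Z b c d > 0 \<longrightarrow>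
     \<not> det2 Y Z a b d > 0 \<and> \<not> det2 Y Z a c d > 0"
  proof (intro ballI impI)
    fix a b c d assume X: "a \<in> X" "b \<in> X" "c \<in> X" "d \<in> X"
      and h: "a < b \<and> b < c \<and> c < d \<and> \<not> det2 Y Z a b c > 0 \<and> \<not> det2 Y Z b c d > 0"
    note p = *[OF X] h
    have "det2 Y Z a b d * (Y c - Y b) \<le> 0" "det2 Y Z a c d * (Y c - Y b) \<le> 0"
      unfolding det2_plucker_left[of Y Z a b d c] det2_plucker_right[of Y Z a c d b]
      using p by (intro add_nonpos_nonpos mult_nonpos_nonneg; simp)+
    then show "\<not> det2 Y Z a b d > 0 \<and> \<not> det2 Y Z a c d > 0"
      using p by (metis mult_pos_pos not_le)
  qed
qed

section \<open>Ramsey-type lemmas\<close>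

lemma set_subseq_subset: "subseq xs ys \<Longrightarrow> set xs \<subseteq> set ys"
  by (auto simp: subseq_conv_nths dest: in_set_nthsD)

text \<open>Each predicate in turn keeps the larger of its two classes, at the cost of a factor
  2.\<close>

lemma subseq_constant_on_predicates:
  fixes Qs :: "('a \<Rightarrow> bool) list"
  assumes "2 ^ length Qs * L \<le> length ys"
  shows "\<exists>zs. subseq zs ys \<and> L \<le> length zs \<and>
           (\<forall>Q\<in>set Qs. \<forall>x\<in>set zs. \<forall>y\<in>set zs. Q x = Q y)"
  using assms
proof (induction Qs arbitrary: ys)
  case Nil
  then show ?case by (intro exI[of _ ys]) auto
next
  case (Cons Q Qs)
  have "length (filter Q ys) + length (filter (\<lambda>x. \<not> Q x) ys) = length ys"
    by (rule sum_length_filter_compl)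
  then have "2 ^ length Qs * L \<le> length (filter Q ys) \<or>
      2 ^ length Qs * L \<le> length (filter (\<lambda>x. \<not> Q x) ys)"
    using Cons.prems by auto
  then obtain b where "2 ^ length Qs * L \<le> length (filter (\<lambda>x. Q x = b) ys)"
    by (elim disjE) (auto intro: that[of True] that[of False])
  from Cons.IH[OF this] obtain zs where zs: "subseq zs (filter (\<lambda>x. Q x = b) ys)" "L \<le> length zs"
      "\<forall>Q\<in>set Qs. \<forall>x\<in>set zs. \<forall>y\<in>set zs. Q x = Q y"
    by blast
  have "Q x = b" if "x \<in> set zs" for x
    using that set_subseq_subset[OF zs(1)] by auto
  moreover have "subseq zs ys"
    using zs(1) subseq_filter_left subseq_order.trans by blast
  ultimately show ?case
    using zs by (intro exI[of _ zs]) auto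
qed

text \<open>The accumulator \<open>xs\<close> holds the elements chosen so far. The head of
  \<open>ys\<close> is chosen next, and the rest is thinned out until, for every pair in
  \<open>xs\<close>, the colour of this pair with the new element is the same for all remaining
  fourth elements.\<close>

lemma end_homogeneous_subseq_aux:
  fixes C :: "'a \<Rightarrow> 'a \<Rightarrow> 'a \<Rightarrow> 'a \<Rightarrow> bool"
  assumes "length xs + m \<le> M" and "2 ^ ((M * M + 1) * m) \<le> length ys"
  shows "\<exists>zs. subseq zs ys \<and> length zs = m \<and>
           (\<forall>j<m. \<forall>a\<in>set (xs @ take j zs). \<forall>b\<in>set (xs @ take j zs). \<forall>l l'.
              j < l \<and> l < m \<and> j < l' \<and> l' < m \<longrightarrow>
              C a b (zs ! j) (zs ! l) = C a b (zs ! j) (zs ! l'))"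
  using assms
proof (induction m arbitrary: xs ys)
  case 0
  then show ?case by (intro exI[of _ "[]"]) auto
next
  case (Suc m)
  obtain y ys1 where ys: "ys = y # ys1"
    using Suc.prems(2) by (cases ys) auto
  define Qs where "Qs = map (\<lambda>(a, b). C a b y) (List.product xs xs)"
  define L :: nat where "L = 2 ^ ((M * M + 1) * m)"
  \<comment> \<open>One predicate for each pair from the accumulator, whose length never exceeds
    \<open>M\<close>.\<close>
  have "length Qs \<le> M * M"
    using Suc.prems(1) by (auto simp: Qs_def intro!: mult_mono)
  then have le: "(2::nat) ^ length Qs * L \<le> 2 ^ (M * M) * L"
    by (intro mult_right_mono power_increasing) auto
  \<comment> \<open>The \<open>+ 1\<close> in the exponent is a spare factor 2, which pays for
    dropping the head \<open>y\<close>.\<close>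
  have half: "2 * (2 ^ (M * M) * L) \<le> length ys"
    using Suc.prems(2) by (simp add: L_def power_add algebra_simps)
  have pos: "2 ^ (M * M) * L > 0"
    by (simp add: L_def)
  have len: "length ys = length ys1 + 1"
    using ys by simp
  have arith: "r \<le> l" if "r \<le> X" "2 * X \<le> n" "X > 0" "n = l + 1" for r X n l :: nat
    using that by linarith
  have "2 ^ length Qs * L \<le> length ys1"
    by (rule arith[OF le half pos len])
  from subseq_constant_on_predicates[OF this] obtain ys2 where
    ys2: "subseq ys2 ys1" "L \<le> length ys2"
      "\<forall>Q\<in>set Qs. \<forall>x\<in>set ys2. \<forall>y\<in>set ys2. Q x = Q y"
    by blast
  from Suc.IH[of "xs @ [y]" ys2] ys2(2) Suc.prems(1) obtain zs where
    zs: "subseq zs ys2" "length zs = m"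
      "\<forall>j<m. \<forall>a\<in>set ((xs @ [y]) @ take j zs). \<forall>b\<in>set ((xs @ [y]) @ take j zs). \<forall>l l'.
              j < l \<and> l < m \<and> j < l' \<and> l' < m \<longrightarrow>
              C a b (zs ! j) (zs ! l) = C a b (zs ! j) (zs ! l')"
    unfolding L_def by auto
  \<comment> \<open>This settles \<open>y\<close> as third argument. Later third arguments are
    covered by the induction hypothesis, whose accumulator contains \<open>y\<close>.\<close>
  have c0: "C a b y x = C a b y x'"
    if "a \<in> set xs" "b \<in> set xs" "x \<in> set zs" "x' \<in> set zs" for a b x x'
  proof -
    have "C a b y \<in> set Qs"
      using that by (force simp: Qs_def)
    then show ?thesis
      using ys2(3) set_subseq_subset[OF zs(1)] that by blast
  qed
  show ?case
  proof (intro exI[of _ "y # zs"] conjI allI ballI impI)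
    show "subseq (y # zs) ys"
      using zs(1) ys2(1) ys by (auto intro: subseq_order.trans)
    fix j a b l l'
    assume j: "j < Suc m" and ab: "a \<in> set (xs @ take j (y # zs))" "b \<in> set (xs @ take j (y # zs))"
      and l: "j < l \<and> l < Suc m \<and> j < l' \<and> l' < Suc m"
    show "C a b ((y # zs) ! j) ((y # zs) ! l) = C a b ((y # zs) ! j) ((y # zs) ! l')"
    proof (cases j)
      case 0
      then show ?thesis
        using ab l zs(2) c0[of a b "zs ! (l - 1)" "zs ! (l' - 1)"] by auto
    next
      case (Suc i)
      then obtain e e' where e: "l = Suc e" "l' = Suc e'"
        using l by (metis less_imp_Suc_add add_Suc_right)
      have "a \<in> set ((xs @ [y]) @ take i zs)" "b \<in> set ((xs @ [y]) @ take i zs)"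
        using ab Suc by auto
      then show ?thesis
        using zs(3)[rule_format, of i a b e e'] l j Suc e by auto
    qed
  qed (use zs(2) in simp)
qed

lemma end_homogeneous_subseq:
  fixes C :: "'a \<Rightarrow> 'a \<Rightarrow> 'a \<Rightarrow> 'a \<Rightarrow> bool"
  assumes "2 ^ ((m * m + 1) * m) \<le> length ys"
  shows "\<exists>zs. subseq zs ys \<and> length zs = m \<and>
           (\<forall>h i j l l'. h < i \<and> i < j \<and> j < l \<and> l < m \<and> j < l' \<and> l' < m \<longrightarrow>
              C (zs ! h) (zs ! i) (zs ! j) (zs ! l) = C (zs ! h) (zs ! i) (zs ! j) (zs ! l'))"
proof -
  obtain zs where zs: "subseq zs ys" "length zs = m"
    "\<And>j a b l l'. j < m \<Longrightarrow> a \<in> set (take j zs) \<Longrightarrow> b \<in> set (take j zs) \<Longrightarrow>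
      j < l \<and> l < m \<and> j < l' \<and> l' < m \<Longrightarrow> C a b (zs ! j) (zs ! l) = C a b (zs ! j) (zs ! l')"
    using end_homogeneous_subseq_aux[of "[]" m m ys C] assms by auto
  have "zs ! h \<in> set (take j zs)" if "h < j" "j < m" for h j
    using that zs(2) by (metis in_set_conv_nth length_take min.absorb4 nth_take)
  then show ?thesis
    using zs by (intro exI[of _ zs]) auto
qed

text \<open>The monotone subsequence theorem of Erdos and Szekeres in terms of chains and
  antichains. Either the \<open>R\<close>-minimal elements, which are pairwise unrelated, are
  numerous enough, or a chain among the other elements can be prolonged downwards.\<close>

lemma erdos_szekeres_chain_antichain:
  fixes R :: "'a::linorder \<Rightarrow> 'a \<Rightarrow> bool"
  assumes "finite X" "k * l \<le> card X"
    and trans: "\<And>a b c. a \<in> X \<Longrightarrow> b \<in> X \<Longrightarrow> c \<in> X \<Longrightarrow> a < b \<Longrightarrow> b < c \<Longrightarrow> R a b \<Longrightarrow> R b c \<Longrightarrow> R a c"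
  shows "\<exists>Y\<subseteq>X. card Y = k \<and> (\<forall>a\<in>Y. \<forall>b\<in>Y. a < b \<longrightarrow> R a b) \<or>
           card Y = l \<and> (\<forall>a\<in>Y. \<forall>b\<in>Y. a < b \<longrightarrow> \<not> R a b)"
  using assms
proof (induction k arbitrary: X)
  case 0
  then show ?case by (intro exI[of _ "{}"]) auto
next
  case (Suc k)
  define A where "A = {z \<in> X. \<forall>a\<in>X. a < z \<longrightarrow> \<not> R a z}"
  have A: "A \<subseteq> X" "finite A"
    using Suc.prems(1) by (auto simp: A_def)
  show ?case
  proof (cases "l \<le> card A")
    case True
    then obtain Y where "Y \<subseteq> A" "card Y = l"
      using A(2) by (meson obtain_subset_with_card_n)
    then show ?thesis
      by (intro exI[of _ Y]) (auto simp: A_def)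
  next
    case False
    then have "k * l \<le> card (X - A)"
      using Suc.prems(2) A by (auto simp: card_Diff_subset)
    then have "\<exists>Y\<subseteq>X - A. card Y = k \<and> (\<forall>a\<in>Y. \<forall>b\<in>Y. a < b \<longrightarrow> R a b) \<or>
       card Y = l \<and> (\<forall>a\<in>Y. \<forall>b\<in>Y. a < b \<longrightarrow> \<not> R a b)"
      using Suc.prems(1) by (intro Suc.IH) (auto intro: Suc.prems(3))
    then obtain Y where Y: "Y \<subseteq> X - A"
      "card Y = k \<and> (\<forall>a\<in>Y. \<forall>b\<in>Y. a < b \<longrightarrow> R a b) \<or>
       card Y = l \<and> (\<forall>a\<in>Y. \<forall>b\<in>Y. a < b \<longrightarrow> \<not> R a b)"
      by blast
    show ?thesis
    proof (cases "card Y = k \<and> (\<forall>a\<in>Y. \<forall>b\<in>Y. a < b \<longrightarrow> R a b)")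
      case True
      have finY: "finite Y"
        using Y(1) Suc.prems(1) by (meson finite_Diff finite_subset)
      show ?thesis
      proof (cases "Y = {}")
        case True
        \<comment> \<open>Here \<open>k = 0\<close>, and any single point is a chain of length
          1.\<close>
        have "X \<noteq> {}"
          using Suc.prems(2) False by (cases "l = 0") auto
        then obtain x where "x \<in> X" by blast
        then show ?thesis
          using True \<open>card Y = k \<and> _\<close> by (intro exI[of _ "{x}"]) auto
      next
        case False
        \<comment> \<open>The least element of the chain is not \<open>R\<close>-minimal, so it has
          a predecessor \<open>a\<close>, and transitivity relates \<open>a\<close> to the whole
          chain.\<close>
        define c where "c = Min Y"
        have c: "c \<in> Y" "\<And>y. y \<in> Y \<Longrightarrow> c \<le> y"
          using finY False by (auto simp: c_def)
        then obtain a where a: "a \<in> X" "a < c" "R a c"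
          using Y(1) unfolding A_def by auto
        have "a \<notin> Y"
          using a c(2) by (meson leD)
        moreover have "R a y" if "y \<in> Y" for y
        proof (cases "y = c")
          case False
          then have "c < y" using c(2)[OF that] by simp
          moreover have "y \<in> X" "c \<in> X" using that c(1) Y(1) by auto
          ultimately show ?thesis
            using Suc.prems(3)[of a c y] a True that c(1) by blast
        qed (use a in simp)
        moreover have "\<not> y < a" if "y \<in> Y" for y
          using that a c by (meson leD less_trans)
        ultimately show ?thesis
          using True Y(1) a(1) finY by (intro exI[of _ "insert a Y"]) auto
      qed
    next
      case False
      then show ?thesis
        using Y by (intro exI[of _ Y]) blast
    qed
  qed
qed

section \<open>Cups and caps\<close>

definition triple_homogeneous :: "('a::linorder \<Rightarrow> 'a \<Rightarrow> 'a \<Rightarrow> bool) \<Rightarrow> 'a set \<Rightarrow> bool" where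
  "triple_homogeneous T Y \<longleftrightarrow> (\<forall>a\<in>Y. \<forall>b\<in>Y. \<forall>c\<in>Y. a < b \<and> b < c \<longrightarrow> T a b c)"

text \<open>The property of planar orientations on which the cup-cap argument rests: it spreads
  \<open>T\<close> from consecutive triples to all triples.\<close>

definition triple_transitive :: "('a::linorder \<Rightarrow> 'a \<Rightarrow> 'a \<Rightarrow> bool) \<Rightarrow> 'a set \<Rightarrow> bool" where
  "triple_transitive T X \<longleftrightarrow> (\<forall>a\<in>X. \<forall>b\<in>X. \<forall>c\<in>X. \<forall>d\<in>X.
     a < b \<and> b < c \<and> c < d \<and> T a b c \<and> T b c d \<longrightarrow> T a b d \<and> T a c d)"

lemma triple_transitive_subset:
  "triple_transitive T X \<Longrightarrow> Y \<subseteq> X \<Longrightarrow> triple_transitive T Y"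
  unfolding triple_transitive_def by (meson subsetD)

lemma triple_homogeneous_small:
  assumes "finite Y" "card Y \<le> 2"
  shows "triple_homogeneous T Y"
  unfolding triple_homogeneous_def
proof (intro ballI impI)
  fix a b c assume "a \<in> Y" "b \<in> Y" "c \<in> Y" "a < b \<and> b < c"
  then have "{a, b, c} \<subseteq> Y" "a \<noteq> b" "b \<noteq> c" "a \<noteq> c" by auto
  then have "card {a, b, c} \<le> card Y" "card {a, b, c} = 3"
    using card_mono[OF assms(1)] by (blast, simp)
  then show "T a b c"
    using assms by auto
qed

text \<open>\<open>y\<close> and \<open>z\<close> are the last two elements of \<open>Y\<close>.
  From \<open>T y z x\<close>, transitivity yields the triples \<open>a z x\<close> and
  \<open>a y x\<close>, and the latter yield \<open>a b x\<close> for \<open>b < y\<close>.\<close>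

lemma triple_homogeneous_insert_above:
  assumes T: "triple_homogeneous T Y" "triple_transitive T X" "insert x Y \<subseteq> X"
    and z: "z \<in> Y" "\<And>v. v \<in> Y \<Longrightarrow> v \<le> z" and y: "y \<in> Y" "y < z" "\<And>v. v \<in> Y \<Longrightarrow> v \<noteq> z \<Longrightarrow> v \<le> y"
    and x: "z < x" "T y z x"
  shows "triple_homogeneous T (insert x Y)"
proof -
  have Tz: "T a z x" if "a \<in> Y" "a < z" for a
  proof (cases "a = y")
    case False
    then have "a < y" using that y(3)[of a] by (simp add: order.strict_iff_order)
    then show ?thesis
      using that T x y z unfolding triple_homogeneous_def triple_transitive_def
      by (meson insert_subset subsetD)
  qed (use x in simp)
  have Ty: "T a y x" if "a \<in> Y" "a < y" for a
    using that T x y z unfolding triple_homogeneous_def triple_transitive_def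
    by (meson insert_subset subsetD)
  have Tall: "T a b x" if ab: "a \<in> Y" "b \<in> Y" "a < b" for a b
  proof -
    consider "b = z" | "b = y" | "b < y" using y(3)[of b] ab by fastforce
    then show ?thesis
    proof cases
      case 3
      then have "T a b y" "T b y x"
        using T(1) Ty ab y unfolding triple_homogeneous_def by auto
      then show ?thesis
        using T(2,3) ab y x 3 unfolding triple_transitive_def
        by (meson insert_subset subsetD less_trans)
    qed (use Tz Ty ab in auto)
  qed
  have lt: "v < x" if "v \<in> Y" for v
    using z(2)[OF that] x(1) by auto
  then show ?thesis
    using T(1) Tall unfolding triple_homogeneous_def by (metis insert_iff less_asym' order_less_irrefl)
qed

text \<open>The mirror image, with \<open>z\<close> and \<open>y\<close> the first two elements of
  \<open>Y\<close>.\<close>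

lemma triple_homogeneous_insert_below:
  assumes T: "triple_homogeneous T Y" "triple_transitive T X" "insert x Y \<subseteq> X"
    and z: "z \<in> Y" "\<And>v. v \<in> Y \<Longrightarrow> z \<le> v" and y: "y \<in> Y" "z < y" "\<And>v. v \<in> Y \<Longrightarrow> v \<noteq> z \<Longrightarrow> y \<le> v"
    and x: "x < z" "T x z y"
  shows "triple_homogeneous T (insert x Y)"
proof -
  have Tz: "T x z a" if "a \<in> Y" "z < a" for a
  proof (cases "a = y")
    case False
    then have "y < a" using that y(3)[of a] by (metis order.strict_iff_order)
    then show ?thesis
      using that T x y z unfolding triple_homogeneous_def triple_transitive_def
      by (meson insert_subset subsetD)
  qed (use x in simp)
  have Ty: "T x y a" if "a \<in> Y" "y < a" for a
    using that T x y z unfolding triple_homogeneous_def triple_transitive_def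
    by (meson insert_subset subsetD)
  have Tall: "T x b a" if ab: "a \<in> Y" "b \<in> Y" "b < a" for a b
  proof -
    consider "b = z" | "b = y" | "y < b" using y(3)[of b] ab by fastforce
    then show ?thesis
    proof cases
      case 3
      then have "T y b a" "T x y b"
        using T(1) Ty ab y unfolding triple_homogeneous_def by auto
      then show ?thesis
        using T(2,3) ab y x 3 unfolding triple_transitive_def
        by (meson insert_subset subsetD less_trans)
    qed (use Tz Ty ab in auto)
  qed
  have lt: "x < v" if "v \<in> Y" for v
    using z(2)[OF that] x(1) by auto
  then show ?thesis
    using T(1) Tall unfolding triple_homogeneous_def by (metis insert_iff less_asym' order_less_irrefl)
qed

text \<open>The cup-cap theorem of Erdos and Szekeres for abstract triples. The bound
  \<open>2 ^ (k + l)\<close> is cruder than the usual binomial coefficient, but it is the sum of the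
  bounds for the two smaller pairs, as the induction requires.\<close>

lemma cups_caps:
  fixes T :: "'a::linorder \<Rightarrow> 'a \<Rightarrow> 'a \<Rightarrow> bool"
  assumes "finite X" "2 ^ (k + l) \<le> card X"
    and "triple_transitive T X" "triple_transitive (\<lambda>a b c. \<not> T a b c) X"
  shows "\<exists>Y\<subseteq>X. card Y = k \<and> triple_homogeneous T Y \<or>
           card Y = l \<and> triple_homogeneous (\<lambda>a b c. \<not> T a b c) Y"
  using assms
proof (induction "k + l" arbitrary: k l X)
  case 0
  then show ?case
    by (intro exI[of _ "{}"]) (auto simp: triple_homogeneous_def)
next
  case (Suc s)
  let ?F = "\<lambda>a b c. \<not> T a b c"
  have kl: "k \<le> card X" "l \<le> card X"
    using Suc.prems(2) less_exp[of "k + l"] by linarith+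
  show ?case
  proof (cases "k \<le> 2 \<or> l \<le> 2")
    case True
    then show ?thesis
      using kl Suc.prems(1)
      by (metis finite_subset obtain_subset_with_card_n triple_homogeneous_small)
  next
    case False
    then obtain k' l' where k': "k = Suc k'" "2 \<le> k'" and l': "l = Suc l'" "2 \<le> l'"
      by (metis Suc_le_mono not_less_eq_eq numeral_2_eq_2 numeral_3_eq_3 Suc_le_D)
    \<comment> \<open>\<open>E\<close> collects the right ends of the homogeneous \<open>k'\<close>-sets. If its complement is small, a dual
      homogeneous set in \<open>E\<close> meets one of these in a point, and one of the two can be prolonged.\<close>
    define E where "E = {z \<in> X. \<exists>Y\<subseteq>X. card Y = k' \<and> triple_homogeneous T Y \<and> z \<in> Y \<and> (\<forall>v\<in>Y. v \<le> z)}"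
    have E: "E \<subseteq> X" "finite E"
      using Suc.prems(1) by (auto simp: E_def)
    have "(2::nat) ^ (k + l) = 2 ^ (k' + l) + 2 ^ (k + l')"
      by (simp add: k' l')
    then have "2 ^ (k' + l) \<le> card (X - E) \<or> 2 ^ (k + l') \<le> card E"
      using Suc.prems(2) E by (auto simp: card_Diff_subset)
    then show ?thesis
    proof
      assume "2 ^ (k' + l) \<le> card (X - E)"
      then have "\<exists>Y\<subseteq>X - E. card Y = k' \<and> triple_homogeneous T Y \<or> card Y = l \<and> triple_homogeneous ?F Y"
        using Suc.prems Suc.hyps(2) k'
        by (intro Suc.hyps(1)) (auto intro: triple_transitive_subset)
      then obtain Y where Y: "Y \<subseteq> X - E"
        "card Y = k' \<and> triple_homogeneous T Y \<or> card Y = l \<and> triple_homogeneous ?F Y"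
        by blast
      \<comment> \<open>The maximum of such a \<open>Y\<close> would belong to
        \<open>E\<close>.\<close>
      have "\<not> (card Y = k' \<and> triple_homogeneous T Y)"
      proof
        assume *: "card Y = k' \<and> triple_homogeneous T Y"
        then have fin: "finite Y" "Y \<noteq> {}"
          using k' by (auto intro: card_ge_0_finite)
        then have "Max Y \<in> Y" "\<forall>v\<in>Y. v \<le> Max Y"
          by auto
        moreover from this have "Max Y \<in> E"
          using * Y(1) unfolding E_def by (intro CollectI conjI exI[of _ Y]) auto
        ultimately show False
          using Y(1) by blast
      qed
      then show ?thesis
        using Y by (intro exI[of _ Y]) auto
    next
      assume "2 ^ (k + l') \<le> card E"
      then have "\<exists>Y\<subseteq>E. card Y = k \<and> triple_homogeneous T Y \<or> card Y = l' \<and> triple_homogeneous ?F Y"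
        using Suc.prems Suc.hyps(2) l' E
        by (intro Suc.hyps(1)) (auto intro: triple_transitive_subset)
      then obtain Z where Z: "Z \<subseteq> E"
        "card Z = k \<and> triple_homogeneous T Z \<or> card Z = l' \<and> triple_homogeneous ?F Z"
        by blast
      show ?thesis
      proof (cases "card Z = k \<and> triple_homogeneous T Z")
        case True
        then show ?thesis using Z E by (intro exI[of _ Z]) auto
      next
        case False
        then have Z': "card Z = l'" "triple_homogeneous ?F Z"
          using Z by auto
        have finZ: "finite Z" "Z \<noteq> {}"
          using Z' l' by (auto intro: card_ge_0_finite)
        define z where "z = Min Z"
        have z: "z \<in> Z" "\<And>v. v \<in> Z \<Longrightarrow> z \<le> v"
          using finZ by (auto simp: z_def)
        have "card (Z - {z}) \<ge> 1"
          using Z' l' z by (simp add: card_Diff_subset)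
        then have neZ: "Z - {z} \<noteq> {}" by force
        define x where "x = Min (Z - {z})"
        have x: "x \<in> Z" "x \<noteq> z" "\<And>v. v \<in> Z \<Longrightarrow> v \<noteq> z \<Longrightarrow> x \<le> v"
          using Min_in[of "Z - {z}"] neZ finZ by (auto simp: x_def)
        have "z \<in> E"
          using z(1) Z(1) by (rule subsetD[rotated])
        then obtain Y where Y: "Y \<subseteq> X" "card Y = k'" "triple_homogeneous T Y" "z \<in> Y" "\<And>v. v \<in> Y \<Longrightarrow> v \<le> z"
          by (auto simp: E_def)
        have finY: "finite Y"
          using Y(1) Suc.prems(1) finite_subset by blast
        have "card (Y - {z}) \<ge> 1"
          using Y k' by (simp add: card_Diff_subset)
        then have neY: "Y - {z} \<noteq> {}" by force
        define y where "y = Max (Y - {z})"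
        have y: "y \<in> Y" "y \<noteq> z" "\<And>v. v \<in> Y \<Longrightarrow> v \<noteq> z \<Longrightarrow> v \<le> y"
          using Max_in[of "Y - {z}"] neY finY by (auto simp: y_def)
        have lt: "y < z" "z < x"
          using Y(5)[OF y(1)] y(2) z(2)[OF x(1)] x(2) by auto
        have sub: "insert x Y \<subseteq> X" "insert y Z \<subseteq> X"
          using x(1) Z(1) E(1) Y(1) y(1) by auto
        show ?thesis
        proof (cases "T y z x")
          case True
          have "triple_homogeneous T (insert x Y)"
            by (rule triple_homogeneous_insert_above[OF Y(3) Suc.prems(3) sub(1) Y(4,5) y(1) lt(1) y(3) lt(2) True])
          moreover have "x \<notin> Y"
            using Y(5)[of x] lt by auto
          ultimately show ?thesis
            using sub Y(2) finY k' by (intro exI[of _ "insert x Y"]) auto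
        next
          case False
          have "triple_homogeneous ?F (insert y Z)"
            by (rule triple_homogeneous_insert_below[OF Z'(2) Suc.prems(4) sub(2) z x(1) lt(2) x(3) lt(1) False])
          moreover have "y \<notin> Z"
            using z(2)[of y] lt by auto
          ultimately show ?thesis
            using sub Z'(1) finZ l' by (intro exI[of _ "insert y Z"]) auto
        qed
      qed
    qed
  qed
qed

section \<open>The upper bound\<close>

lemma subseq_imp_map_nth:
  assumes "subseq xs ys"
  shows "\<exists>ix. sorted_wrt (<) ix \<and> set ix \<subseteq> {..<length ys} \<and> xs = map ((!) ys) ix"
proof -
  obtain A where "xs = nths ys A"
    using assms by (auto simp: subseq_conv_nths)
  also have "zip ys [0..<length ys] = map (\<lambda>i. (ys ! i, i)) [0..<length ys]"
    by (rule nth_equalityI) auto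
  then have "nths ys A = map ((!) ys) (filter (\<lambda>i. i \<in> A) [0..<length ys])"
    by (simp add: nths_def filter_map o_def)
  finally show ?thesis
    by (intro exI[of _ "filter (\<lambda>i. i \<in> A) [0..<length ys]"]) (auto intro: sorted_wrt_filter)
qed

lemma subseq_map_nth_sorted_list:
  assumes "S \<subseteq> {..<length ys}"
  shows "subseq (map ((!) ys) (sorted_list_of_set S)) ys"
proof -
  have "sorted_list_of_set S = filter (\<lambda>i. i \<in> S) [0..<length ys]"
    using assms by (intro sorted_distinct_set_unique) (auto simp: finite_subset sorted_wrt_filter)
  then have "subseq (sorted_list_of_set S) [0..<length ys]"
    by simp
  then have "subseq (map ((!) ys) (sorted_list_of_set S)) (map ((!) ys) [0..<length ys])"
    by (rule subseq_map)
  then show ?thesis by (simp add: map_nth)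
qed

lemma general_position_subseq:
  assumes "subseq qs ps" "general_position ps"
  shows "general_position qs"
proof -
  obtain ix where ix: "sorted_wrt (<) ix" "set ix \<subseteq> {..<length ps}" "qs = map ((!) ps) ix"
    using subseq_imp_map_nth[OF assms(1)] by blast
  have lt: "ix ! i < ix ! j" if "i < j" "j < length qs" for i j
    using that ix(1,3) by (simp add: sorted_wrt_iff_nth_less)
  have bound: "ix ! j < length ps" if "j < length qs" for j
    using that ix(2,3) by (metis length_map lessThan_iff nth_mem subsetD)
  have nth: "qs ! i = ps ! (ix ! i)" if "i < length qs" for i
    using that ix(3) by simp
  show ?thesis
    unfolding general_position_def
  proof (intro conjI allI impI)
    fix i j k l assume h: "i < j \<and> j < k \<and> k < l \<and> l < length qs"
    then show "\<not> coplanar {qs ! i, qs ! j, qs ! k, qs ! l}"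
      using assms(2)[unfolded general_position_def, THEN conjunct1, rule_format, of "ix ! i" "ix ! j" "ix ! k" "ix ! l"]
      by (simp add: nth lt bound)
  next
    fix c i j assume h: "i < j \<and> j < length qs"
    then show "qs ! i $ c \<noteq> qs ! j $ c"
      using assms(2)[unfolded general_position_def, THEN conjunct2, rule_format, of "ix ! i" "ix ! j" c]
      by (simp add: nth lt bound)
  qed
qed

section \<open>Ramsey bounds for points in the plane and vectors in space\<close>

lemma planar_ramsey_mono:
  fixes Y Z :: "'a::linorder \<Rightarrow> real"
  assumes "finite X" "2 ^ (n + n) \<le> card X"
    and mono: "\<And>a b. a \<in> X \<Longrightarrow> b \<in> X \<Longrightarrow> a < b \<Longrightarrow> Y a < Y b"
    and nz: "\<And>a b c. a \<in> X \<Longrightarrow> b \<in> X \<Longrightarrow> c \<in> X \<Longrightarrow> a < b \<Longrightarrow> b < c \<Longrightarrow> det2 Y Z a b c \<noteq> 0"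
  shows "\<exists>S\<subseteq>X. card S = n \<and> (\<exists>s. \<forall>a\<in>S. \<forall>b\<in>S. \<forall>c\<in>S. a < b \<and> b < c \<longrightarrow> sgn (det2 Y Z a b c) = s)"
proof -
  obtain S where S: "S \<subseteq> X" "card S = n \<and> triple_homogeneous (\<lambda>a b c. det2 Y Z a b c > 0) S \<or>
      card S = n \<and> triple_homogeneous (\<lambda>a b c. \<not> det2 Y Z a b c > 0) S"
    using cups_caps[OF assms(1,2), of "\<lambda>a b c. det2 Y Z a b c > 0"] det2_mono_transitive[of X Y Z, OF mono]
    unfolding triple_transitive_def by blast
  from S(2) show ?thesis
  proof
    assume "card S = n \<and> triple_homogeneous (\<lambda>a b c. det2 Y Z a b c > 0) S"
    then show ?thesis
      using S(1) by (intro exI[of _ S]) (auto simp: triple_homogeneous_def intro!: exI[of _ 1])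
  next
    assume *: "card S = n \<and> triple_homogeneous (\<lambda>a b c. \<not> det2 Y Z a b c > 0) S"
    \<comment> \<open>The cup-cap theorem only excludes positive determinants; \<open>nz\<close>
      excludes zero.\<close>
    have "sgn (det2 Y Z a b c) = -1" if "a \<in> S" "b \<in> S" "c \<in> S" "a < b" "b < c" for a b c
      using * that nz[of a b c] S(1) unfolding triple_homogeneous_def by (force simp: sgn_if)
    then show ?thesis
      using * S(1) by blast
  qed
qed

text \<open>As \<open>16 ^ n\<close> is the square of \<open>2 ^ (n + n)\<close>, there is a subset
  of that size on which \<open>Y\<close> is monotone. If \<open>Y\<close> decreases, the reflection
  to \<open>- Y\<close> makes it increase and reverses all orientations.\<close>

lemma planar_ramsey_distinct:
  fixes Y Z :: "'a::linorder \<Rightarrow> real"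
  assumes "finite X" "16 ^ n \<le> card X"
    and inj: "inj_on Y X"
    and nz: "\<And>a b c. a \<in> X \<Longrightarrow> b \<in> X \<Longrightarrow> c \<in> X \<Longrightarrow> a < b \<Longrightarrow> b < c \<Longrightarrow> det2 Y Z a b c \<noteq> 0"
  shows "\<exists>S\<subseteq>X. card S = n \<and> (\<exists>s. \<forall>a\<in>S. \<forall>b\<in>S. \<forall>c\<in>S. a < b \<and> b < c \<longrightarrow> sgn (det2 Y Z a b c) = s)"
proof -
  have "(16::nat) ^ n = 2 ^ (n + n) * 2 ^ (n + n)"
    by (simp flip: power_add power_mult_distrib)
       (simp add: power_add flip: power_mult_distrib)
  then have "2 ^ (n + n) * 2 ^ (n + n) \<le> card X"
    using assms(2) by simp
  then have "\<exists>T\<subseteq>X. card T = 2 ^ (n + n) \<and> (\<forall>a\<in>T. \<forall>b\<in>T. a < b \<longrightarrow> Y a < Y b) \<or>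
      card T = 2 ^ (n + n) \<and> (\<forall>a\<in>T. \<forall>b\<in>T. a < b \<longrightarrow> \<not> Y a < Y b)"
    by (intro erdos_szekeres_chain_antichain assms(1)) auto
  then obtain T where T: "T \<subseteq> X" "card T = 2 ^ (n + n) \<and> (\<forall>a\<in>T. \<forall>b\<in>T. a < b \<longrightarrow> Y a < Y b) \<or>
      card T = 2 ^ (n + n) \<and> (\<forall>a\<in>T. \<forall>b\<in>T. a < b \<longrightarrow> \<not> Y a < Y b)"
    by blast
  have fin: "finite T"
    using T(1) assms(1) finite_subset by blast
  from T(2) show ?thesis
  proof
    assume "card T = 2 ^ (n + n) \<and> (\<forall>a\<in>T. \<forall>b\<in>T. a < b \<longrightarrow> Y a < Y b)"
    then have "\<exists>S\<subseteq>T. card S = n \<and>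
        (\<exists>s. \<forall>a\<in>S. \<forall>b\<in>S. \<forall>c\<in>S. a < b \<and> b < c \<longrightarrow> sgn (det2 Y Z a b c) = s)"
      using T(1) nz by (intro planar_ramsey_mono fin) (auto simp: subset_iff)
    then show ?thesis
      by (elim exE conjE) (rule exI, rule conjI[OF subset_trans[OF _ T(1)]], assumption, blast)
  next
    assume *: "card T = 2 ^ (n + n) \<and> (\<forall>a\<in>T. \<forall>b\<in>T. a < b \<longrightarrow> \<not> Y a < Y b)"
    have "- Y a < - Y b" if "a \<in> T" "b \<in> T" "a < b" for a b
    proof -
      have "Y a \<noteq> Y b"
        using that inj T(1) by (auto dest: inj_onD)
      moreover have "\<not> Y a < Y b"
        using * that by blast
      ultimately show ?thesis by simp
    qed
    moreover have "det2 (\<lambda>a. - Y a) Z a b c \<noteq> 0" if "a \<in> T" "b \<in> T" "c \<in> T" "a < b" "b < c" for a b c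
      using nz[of a b c] that T(1) by (auto simp: det2_uminus)
    ultimately have "\<exists>S\<subseteq>T. card S = n \<and>
        (\<exists>s. \<forall>a\<in>S. \<forall>b\<in>S. \<forall>c\<in>S. a < b \<and> b < c \<longrightarrow> sgn (det2 (\<lambda>a. - Y a) Z a b c) = s)"
      using * by (intro planar_ramsey_mono fin) simp_all
    then obtain S s where S: "S \<subseteq> T" "card S = n"
      "\<forall>a\<in>S. \<forall>b\<in>S. \<forall>c\<in>S. a < b \<and> b < c \<longrightarrow> sgn (det2 (\<lambda>a. - Y a) Z a b c) = s"
      by blast
    have "sgn (det2 Y Z a b c) = - s" if "a \<in> S" "b \<in> S" "c \<in> S" "a < b" "b < c" for a b c
    proof -
      have "sgn (det2 (\<lambda>a. - Y a) Z a b c) = s"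
        using S(3) that by blast
      then show ?thesis
        by (simp add: det2_uminus sgn_minus minus_equation_iff[of s])
    qed
    then show ?thesis
      using S T(1) by (intro exI[of _ S]) blast
  qed
qed

lemma planar_ramsey:
  fixes Y Z :: "'a::linorder \<Rightarrow> real"
  assumes "finite X" "16 ^ n \<le> card X" "3 \<le> card X"
    and nz: "\<And>a b c. a \<in> X \<Longrightarrow> b \<in> X \<Longrightarrow> c \<in> X \<Longrightarrow> a < b \<Longrightarrow> b < c \<Longrightarrow> det2 Y Z a b c \<noteq> 0"
  shows "\<exists>S\<subseteq>X. card S = n \<and> (\<exists>s. \<forall>a\<in>S. \<forall>b\<in>S. \<forall>c\<in>S. a < b \<and> b < c \<longrightarrow> sgn (det2 Y Z a b c) = s)"
proof -
  \<comment> \<open>Two coinciding points would give a zero determinant with any third point, and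
    \<open>X\<close> contains a third point.\<close>
  have dist: "Y a \<noteq> Y b \<or> Z a \<noteq> Z b" if ab: "a \<in> X" "b \<in> X" "a < b" for a b
  proof (rule ccontr)
    assume "\<not> ?thesis"
    then have eq: "Y a = Y b" "Z a = Z b" by auto
    have "\<not> X \<subseteq> {a, b}"
      using assms(3) card_mono[of "{a, b}" X] ab by auto
    then obtain c where c: "c \<in> X" "c \<noteq> a" "c \<noteq> b" by blast
    then consider "c < a" | "a < c" "c < b" | "b < c"
      by (meson linorder_less_linear)
    then show False
      using nz[of c a b] nz[of a c b] nz[of a b c] ab c eq
      by cases (auto simp: det2_def)
  qed
  \<comment> \<open>Contains the finitely many shears under which two points with distinct
    \<open>Z\<close> get equal first coordinates. Points with equal \<open>Z\<close> have distinct
    \<open>Y\<close>, and every shear keeps them apart.\<close>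
  define B where "B = (\<lambda>(a, b). (Y a - Y b) / (Z b - Z a)) ` (X \<times> X)"
  have "finite B"
    using assms(1) by (simp add: B_def)
  then obtain t where t: "t \<notin> B"
    using ex_new_if_finite infinite_UNIV_char_0 by blast
  have "Y a + t * Z a \<noteq> Y b + t * Z b" if ab: "a \<in> X" "b \<in> X" "a < b" for a b
  proof
    assume eq: "Y a + t * Z a = Y b + t * Z b"
    then have "t * (Z b - Z a) = Y a - Y b"
      by (simp add: algebra_simps)
    moreover have "Z b \<noteq> Z a"
      using dist[OF ab] eq by auto
    ultimately have "t = (Y a - Y b) / (Z b - Z a)"
      by (simp add: field_simps)
    then show False
      using t ab by (auto simp: B_def)
  qed
  then have "inj_on (\<lambda>a. Y a + t * Z a) X"
    by (intro linorder_inj_onI) auto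
  then show ?thesis
    using planar_ramsey_distinct[of X n "\<lambda>a. Y a + t * Z a" Z] assms(1,2) nz
    unfolding det2_shear by blast
qed

text \<open>The factor 2 pays for passing to vectors whose first coordinates have a common sign
  \<open>e\<close>. Their central projections have the same orientations up to the constant factor
  \<open>e * e * e\<close>.\<close>

lemma spatial_ramsey:
  fixes u :: "'a::linorder \<Rightarrow> real^3"
  assumes "finite X" "2 * 16 ^ n \<le> card X" "n \<ge> 1"
    and u1: "\<And>a. a \<in> X \<Longrightarrow> u a $ 1 \<noteq> 0"
    and nz: "\<And>a b c. a \<in> X \<Longrightarrow> b \<in> X \<Longrightarrow> c \<in> X \<Longrightarrow> a < b \<Longrightarrow> b < c \<Longrightarrow> det3 (u a) (u b) (u c) \<noteq> 0"
  shows "\<exists>S\<subseteq>X. card S = n \<and>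
    (\<exists>s. \<forall>a\<in>S. \<forall>b\<in>S. \<forall>c\<in>S. a < b \<and> b < c \<longrightarrow> sgn (det3 (u a) (u b) (u c)) = s)"
proof -
  define P where "P s = {a \<in> X. sgn (u a $ 1) = s}" for s
  have "X = P 1 \<union> P (-1)"
    using u1 by (auto simp: P_def sgn_if)
  then have "card X \<le> card (P 1) + card (P (-1))"
    by (metis card_Un_le)
  then have "16 ^ n \<le> card (P 1) \<or> 16 ^ n \<le> card (P (-1))"
    using assms(2) by linarith
  then obtain e where e: "16 ^ n \<le> card (P e)" by blast
  have PX: "P e \<subseteq> X" "finite (P e)"
    using assms(1) by (auto simp: P_def)
  have "(16::nat) ^ 1 \<le> 16 ^ n"
    using assms(3) by (intro power_increasing) auto
  then have 3: "3 \<le> card (P e)"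
    using e by simp
  define Y Z where "Y a = u a $ 2 / u a $ 1" and "Z a = u a $ 3 / u a $ 1" for a
  have det: "det3 (u a) (u b) (u c) = u a $ 1 * u b $ 1 * u c $ 1 * det2 Y Z a b c"
    if "a \<in> P e" "b \<in> P e" "c \<in> P e" for a b c
    using that PX u1 unfolding Y_def Z_def by (intro det3_eq_det2) auto
  have "det2 Y Z a b c \<noteq> 0" if "a \<in> P e" "b \<in> P e" "c \<in> P e" "a < b" "b < c" for a b c
    using nz[of a b c] that PX det[of a b c] by auto
  from planar_ramsey[OF PX(2) e 3 this]
  obtain S s where S: "S \<subseteq> P e" "card S = n"
    "\<forall>a\<in>S. \<forall>b\<in>S. \<forall>c\<in>S. a < b \<and> b < c \<longrightarrow> sgn (det2 Y Z a b c) = s"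
    by blast
  have "sgn (det3 (u a) (u b) (u c)) = e * e * e * s"
    if "a \<in> S" "b \<in> S" "c \<in> S" "a < b" "b < c" for a b c
  proof -
    have "a \<in> P e" "b \<in> P e" "c \<in> P e"
      using that S(1) by auto
    then show ?thesis
      using S(3) that det[of a b c] by (auto simp: sgn_mult P_def)
  qed
  then show ?thesis
    using S(1,2) PX(1) by (intro exI[of _ S]) blast
qed

text \<open>One of the \<open>m\<close> points is the last point, from which the other
  \<open>2 * 16 ^ n\<close> are projected. The exponent is the price for orientations that do not
  depend on the fourth point.\<close>

lemma OT3_bound_double_exp:
  assumes "n \<ge> 1" and m: "m = 2 * 16 ^ n + 1"
  shows "OT3_bound n (2 ^ ((m * m + 1) * m))"
  unfolding OT3_bound_def
proof (intro allI impI)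
  fix ps :: "(real^3) list"
  assume "length ps = 2 ^ ((m * m + 1) * m) \<and> general_position ps"
  then have len: "2 ^ ((m * m + 1) * m) \<le> length ps" and gp: "general_position ps"
    by auto
  define C where "C p q r s \<longleftrightarrow> det3 (q - p) (r - p) (s - p) > 0" for p q r s
  obtain zs where zs: "subseq zs ps" "length zs = m"
    and C: "\<And>h i j l l'. h < i \<and> i < j \<and> j < l \<and> l < m \<and> j < l' \<and> l' < m \<Longrightarrow>
              C (zs ! h) (zs ! i) (zs ! j) (zs ! l) = C (zs ! h) (zs ! i) (zs ! j) (zs ! l')"
    using end_homogeneous_subseq[OF len, of C] by blast
  have gpz: "general_position zs"
    using general_position_subseq[OF zs(1) gp] .
  have nz: "det3 (zs ! b - zs ! a) (zs ! c - zs ! a) (zs ! d - zs ! a) \<noteq> 0"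
    if "a < b" "b < c" "c < d" "d < m" for a b c d
    using gpz that zs(2) unfolding general_position_def coplanar_iff_det3 by blast
  define q where "q = zs ! (m - 1)"
  define u where "u i = zs ! i - q" for i
  let ?X = "{..<m - 1}"
  have last: "det3 (zs ! b - zs ! a) (zs ! c - zs ! a) (q - zs ! a) = - det3 (u a) (u b) (u c)" for a b c
    unfolding u_def by (rule det3_from_last)
  have unz: "det3 (u a) (u b) (u c) \<noteq> 0" if "a < b" "b < c" "c < m - 1" for a b c
  proof -
    have "det3 (zs ! b - zs ! a) (zs ! c - zs ! a) (q - zs ! a) \<noteq> 0"
      unfolding q_def using that by (intro nz) auto
    then show ?thesis by (simp only: last neg_equal_0_iff_equal not_False_eq_True)
  qed
  have "\<exists>S\<subseteq>?X. card S = n \<and>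
    (\<exists>s. \<forall>a\<in>S. \<forall>b\<in>S. \<forall>c\<in>S. a < b \<and> b < c \<longrightarrow> sgn (det3 (u a) (u b) (u c)) = s)"
  proof (rule spatial_ramsey)
    \<comment> \<open>General position includes distinct first coordinates, which the projection
      needs.\<close>
    show "u a $ 1 \<noteq> 0" if "a \<in> ?X" for a
      using gpz[unfolded general_position_def, THEN conjunct2, rule_format, of a "m - 1" 1] that zs(2)
      by (auto simp: u_def q_def)
    show "det3 (u a) (u b) (u c) \<noteq> 0" if "a \<in> ?X" "b \<in> ?X" "c \<in> ?X" "a < b" "b < c" for a b c
      using that by (intro unz) auto
  qed (use assms in auto)
  then obtain S s where S: "S \<subseteq> ?X" "card S = n"
    and s: "\<forall>a\<in>S. \<forall>b\<in>S. \<forall>c\<in>S. a < b \<and> b < c \<longrightarrow> sgn (det3 (u a) (u b) (u c)) = s"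
    by (elim exE conjE) (rule that)
  have finS: "finite S"
    using S(1) finite_subset by blast
  have ori: "orientation (zs ! a) (zs ! b) (zs ! c) (zs ! d) = - s"
    if abcd: "a \<in> S" "b \<in> S" "c \<in> S" "d \<in> S" "a < b" "b < c" "c < d" for a b c d
  proof -
    have lt: "d < m - 1" "c < m - 1" using abcd S(1) by auto
    \<comment> \<open>The fourth index is moved to \<open>m - 1\<close>, which lies beyond all of
      \<open>S\<close>.\<close>
    have 1: "C (zs ! a) (zs ! b) (zs ! c) (zs ! d) = C (zs ! a) (zs ! b) (zs ! c) q"
      unfolding q_def using C[of a b c d "m - 1"] abcd lt by auto
    have 2: "det3 (zs ! b - zs ! a) (zs ! c - zs ! a) (zs ! d - zs ! a) \<noteq> 0"
      using nz[of a b c d] abcd lt by auto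
    have 3: "det3 (u a) (u b) (u c) \<noteq> 0"
      using abcd lt by (intro unz) auto
    have 4: "sgn (det3 (u a) (u b) (u c)) = s"
      using s abcd by blast
    \<comment> \<open>\<open>C\<close> records only whether a determinant is positive; as both
      determinants are nonzero, this fixes their signs.\<close>
    have flip: "sgn x = - s" if "(x > 0) = (w > 0)" "x \<noteq> 0" "v \<noteq> 0" "sgn v = s" "w = - v" for x v w :: real
      using that by (auto simp: sgn_if)
    show ?thesis
      unfolding orientation_eq_sgn_det3 by (rule flip[OF 1[unfolded C_def] 2 3 4 last])
  qed
  define ix where "ix = sorted_list_of_set S"
  define qs where "qs = map ((!) zs) ix"
  have ix: "sorted_wrt (<) ix" "set ix = S" "length ix = n"
    using finS S(2) by (auto simp: ix_def)
  have "subseq qs zs"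
    unfolding qs_def ix_def using S(1) zs(2) by (intro subseq_map_nth_sorted_list) auto
  then have "subseq qs ps"
    using zs(1) subseq_order.trans by blast
  moreover have "length qs = n"
    using ix by (simp add: qs_def)
  moreover have "order_type_homogeneous qs"
    unfolding order_type_homogeneous_def
  proof (intro exI[of _ "- s"] allI impI)
    fix i j k l assume h: "i < j \<and> j < k \<and> k < l \<and> l < length qs"
    have "ix ! i < ix ! j" "ix ! j < ix ! k" "ix ! k < ix ! l"
      using h ix(1) by (auto simp: sorted_wrt_iff_nth_less qs_def)
    moreover have "ix ! i \<in> S" "ix ! j \<in> S" "ix ! k \<in> S" "ix ! l \<in> S"
      using h ix(2) by (auto simp: qs_def)
    ultimately have "orientation (zs ! (ix ! i)) (zs ! (ix ! j)) (zs ! (ix ! k)) (zs ! (ix ! l)) = - s"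
      by (intro ori)
    then show "orientation (qs ! i) (qs ! j) (qs ! k) (qs ! l) = - s"
      using h by (simp add: qs_def)
  qed
  ultimately show "\<exists>qs. subseq qs ps \<and> length qs = n \<and> order_type_homogeneous qs"
    by blast
qed

lemma log_log_OT3_upper:
  assumes "n \<ge> 3"
  shows "real (OT3 n) \<le> 2 powr (2 powr (24 * real n))"
proof -
  define m :: nat where "m = 2 * 16 ^ n + 1"
  have "OT3 n \<le> 2 ^ ((m * m + 1) * m)"
    unfolding OT3_def using OT3_bound_double_exp[of n m] assms
    by (intro Least_le) (simp add: m_def)
  \<comment> \<open>The product is at most \<open>m ^ 4\<close>, and
    \<open>m \<le> 2 ^ (6 * n)\<close>.\<close>
  also have "(m * m + 1) * m \<le> 2 ^ (24 * n)"
  proof -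
    have "(16::nat) ^ n \<ge> 16 ^ 1"
      using assms by (intro power_increasing) auto
    then have "m \<le> 4 * 16 ^ n" "m \<ge> 2"
      by (auto simp: m_def)
    have "(4::nat) * 16 ^ n = 2 ^ (4 * n + 2)"
      by (simp add: power_add power_mult)
    also have "\<dots> \<le> 2 ^ (6 * n)"
      using assms by (intro power_increasing) auto
    finally have m6: "m \<le> 2 ^ (6 * n)"
      using \<open>m \<le> 4 * 16 ^ n\<close> by simp
    have "1 \<le> m * m"
      using \<open>m \<ge> 2\<close> by simp
    then have "m * m + 1 \<le> 2 * (m * m)"
      by simp
    also have "\<dots> \<le> m * (m * m)"
      using \<open>m \<ge> 2\<close> by (intro mult_right_mono) auto
    finally have "(m * m + 1) * m \<le> m * (m * m) * m"
      by (rule mult_right_mono) simp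
    also have "\<dots> = m ^ 4"
      by (simp add: power4_eq_xxxx)
    also have "\<dots> \<le> (2 ^ (6 * n)) ^ 4"
      using m6 by (intro power_mono) auto
    also have "\<dots> = 2 ^ (24 * n)"
      by (simp flip: power_mult)
    finally show ?thesis .
  qed
  then have "(2::nat) ^ ((m * m + 1) * m) \<le> 2 ^ (2 ^ (24 * n))"
    by (intro power_increasing) auto
  finally have "real (OT3 n) \<le> real (2 ^ (2 ^ (24 * n)))"
    by (rule of_nat_mono)
  also have "\<dots> = 2 powr (2 powr (24 * real n))"
    by (simp add: powr_realpow[symmetric])
  finally show ?thesis .
qed

section \<open>Homogeneous sets of binary expansions\<close>

text \<open>The highest binary digit in which \<open>a\<close> and \<open>b\<close> differ, that is,
  the level of their lowest common ancestor in the binary tree. Equal quotients mean that all digits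
  above \<open>m\<close> agree. For \<open>a = b\<close> the value is 0.\<close>

definition top_bit :: "nat \<Rightarrow> nat \<Rightarrow> nat" where
  "top_bit a b = (LEAST m. a div 2 ^ Suc m = b div 2 ^ Suc m)"

lemma div_power2_mono:
  fixes a b :: nat
  assumes "a div 2 ^ k = b div 2 ^ k" "k \<le> l"
  shows "a div 2 ^ l = b div 2 ^ l"
proof -
  have "n div 2 ^ l = n div 2 ^ k div 2 ^ (l - k)" for n :: nat
    using assms(2) by (simp add: div_mult2_eq[symmetric] power_add[symmetric])
  then show ?thesis
    using assms(1) by simp
qed

lemma top_bit_less:
  assumes "a div 2 ^ M = b div 2 ^ M" "a \<noteq> b"
  shows "top_bit a b < M"
proof (cases M)
  case 0
  then show ?thesis using assms by simp
next
  case (Suc m)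
  then show ?thesis
    unfolding top_bit_def using assms Least_le[of "\<lambda>m. a div 2 ^ Suc m = b div 2 ^ Suc m" m] by simp
qed

lemma top_bit_eqI:
  assumes "a div 2 ^ Suc m = b div 2 ^ Suc m" "a div 2 ^ m \<noteq> b div 2 ^ m"
  shows "top_bit a b = m"
  unfolding top_bit_def
proof (rule Least_equality)
  fix y assume "a div 2 ^ Suc y = b div 2 ^ Suc y"
  then show "m \<le> y"
    using assms(2) div_power2_mono[of a "Suc y" b m] by (meson not_less_eq_eq)
qed (rule assms(1))

lemma top_bit_split:
  assumes "a < b"
  shows "even (a div 2 ^ top_bit a b)" "b div 2 ^ top_bit a b = Suc (a div 2 ^ top_bit a b)"
    and "top_bit a b < i \<Longrightarrow> b div 2 ^ i = a div 2 ^ i"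
proof -
  let ?m = "top_bit a b"
  \<comment> \<open>The least level exists, since both quotients vanish for the exponent
    \<open>Suc b\<close>.\<close>
  have "b < 2 ^ Suc b"
    using less_exp[of "Suc b"] by linarith
  then have "a div 2 ^ Suc b = 0" "b div 2 ^ Suc b = 0"
    using assms by (auto intro!: div_less simp del: power_Suc)
  then have "a div 2 ^ Suc b = b div 2 ^ Suc b"
    by simp
  then have eq: "a div 2 ^ Suc ?m = b div 2 ^ Suc ?m"
    unfolding top_bit_def by (rule LeastI)
  then show "?m < i \<Longrightarrow> b div 2 ^ i = a div 2 ^ i"
    using div_power2_mono[of a "Suc ?m" b i] by simp
  have "a div 2 ^ ?m \<noteq> b div 2 ^ ?m"
    using top_bit_less[of a ?m b] assms by auto
  moreover have "a div 2 ^ ?m \<le> b div 2 ^ ?m"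
    using assms by (intro div_le_mono) auto
  moreover have "a div 2 ^ ?m div 2 = b div 2 ^ ?m div 2"
    using eq by (simp add: div_mult2_eq[symmetric] mult.commute)
  moreover have "even p \<and> q = Suc p" if "p \<noteq> q" "p \<le> q" "p div 2 = q div 2" for p q :: nat
    using that by presburger
  ultimately show "even (a div 2 ^ ?m)" "b div 2 ^ ?m = Suc (a div 2 ^ ?m)"
    by blast+
qed

text \<open>The digit of \<open>b\<close> is 1 at \<open>top_bit a b\<close> and 0 at
  \<open>top_bit b c\<close>.\<close>

lemma top_bit_neq:
  assumes "a < b" "b < c"
  shows "top_bit a b \<noteq> top_bit b c"
  using top_bit_split[OF assms(1)] top_bit_split[OF assms(2)] by auto

text \<open>If \<open>a\<close> separates from \<open>b\<close> and from \<open>c\<close> at the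
  same level, then \<open>b\<close> and \<open>c\<close> share all digits from that level upwards.
  The second part is symmetric.\<close>

lemma top_bit_less_if_eq:
  assumes "a < b" "b < c"
  shows "top_bit a b = top_bit a c \<Longrightarrow> top_bit b c < top_bit a b"
    and "top_bit a c = top_bit b c \<Longrightarrow> top_bit a b < top_bit b c"
proof -
  have "a < c" using assms by simp
  note s = top_bit_split[OF assms(1)] top_bit_split[OF assms(2)] top_bit_split[OF \<open>a < c\<close>]
  show "top_bit b c < top_bit a b" if "top_bit a b = top_bit a c"
    using s that assms by (intro top_bit_less) auto
  show "top_bit a b < top_bit b c" if "top_bit a c = top_bit b c"
    using s that assms by (intro top_bit_less) auto
qed

text \<open>In the planar configuration such a set is a cup or a cap. If consecutive top bits
  increase, the least element separates from the others at distinct levels; otherwise the greatest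
  element does. There are only \<open>K\<close> levels.\<close>

lemma cups_caps_bound:
  assumes A: "A \<subseteq> {..<2 ^ K}"
    and sgn: "\<And>a b c. a \<in> A \<Longrightarrow> b \<in> A \<Longrightarrow> c \<in> A \<Longrightarrow> a < b \<Longrightarrow> b < c \<Longrightarrow>
      sgn (real (top_bit b c) - real (top_bit a b)) = s"
  shows "card A \<le> K + 1"
proof (cases "A = {}")
  case False
  have fin: "finite A"
    using A finite_subset by blast
  have lt: "top_bit a b < K" if "a \<in> A" "b \<in> A" "a < b" for a b
    using that A by (intro top_bit_less) (auto simp: subset_iff)
  have "\<exists>x\<in>A. card (A - {x}) \<le> K"
  proof (cases "s = 1")
    case True
    define m where "m = Min A"
    have m: "m \<in> A" "\<And>x. x \<in> A - {m} \<Longrightarrow> m < x"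
      using fin False by (auto simp: m_def order.strict_iff_order)
    have "inj_on (top_bit m) (A - {m})"
    proof (rule linorder_inj_onI)
      fix x y assume xy: "x < y" "x \<in> A - {m}" "y \<in> A - {m}"
      then have "top_bit m x < top_bit x y"
        using sgn[of m x y] m True by (auto simp: sgn_if split: if_splits)
      then show "top_bit m x \<noteq> top_bit m y"
        using top_bit_less_if_eq(1)[of m x y] m(2)[of x] xy by auto
    qed auto
    moreover have "top_bit m ` (A - {m}) \<subseteq> {..<K}"
      using lt m by auto
    ultimately have "card (A - {m}) \<le> card {..<K}"
      by (intro card_inj_on_le) auto
    then show ?thesis using m by auto
  next
    case False
    define m where "m = Max A"
    have m: "m \<in> A" "\<And>x. x \<in> A - {m} \<Longrightarrow> x < m"
      using fin \<open>A \<noteq> {}\<close> by (auto simp: m_def order.strict_iff_order)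
    have "inj_on (\<lambda>x. top_bit x m) (A - {m})"
    proof (rule linorder_inj_onI)
      fix x y assume xy: "x < y" "x \<in> A - {m}" "y \<in> A - {m}"
      then have "top_bit y m \<le> top_bit x y"
        using sgn[of x y m] m False by (auto simp: sgn_if split: if_splits)
      then show "top_bit x m \<noteq> top_bit y m"
        using top_bit_less_if_eq(2)[of x y m] m(2)[of y] xy by auto
    qed auto
    moreover have "(\<lambda>x. top_bit x m) ` (A - {m}) \<subseteq> {..<K}"
      using lt m by auto
    ultimately have "card (A - {m}) \<le> card {..<K}"
      by (intro card_inj_on_le) auto
    then show ?thesis using m by auto
  qed
  then show ?thesis
    using fin by (auto simp: card_Diff_singleton)
qed simp

text \<open>What homogeneity of orientations means for the indices, with \<open>\<tau>\<close> the
  orientation of three levels. Quadruples with \<open>top_bit a b = top_bit c d\<close> are left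
  out, because two of their levels coincide.\<close>

definition homogeneous4 :: "(nat \<Rightarrow> nat \<Rightarrow> nat \<Rightarrow> real) \<Rightarrow> real \<Rightarrow> nat set \<Rightarrow> bool" where
  "homogeneous4 \<tau> \<sigma> S \<longleftrightarrow> (\<forall>a\<in>S. \<forall>b\<in>S. \<forall>c\<in>S. \<forall>d\<in>S. a < b \<and> b < c \<and> c < d \<and> top_bit a b \<noteq> top_bit c d
     \<longrightarrow> \<tau> (top_bit a b) (top_bit b c) (top_bit c d) = \<sigma>)"

text \<open>What \<open>homogeneous4\<close> says about triples once a further point separates from
  all of \<open>S\<close> at level \<open>k\<close>. That point may lie on either side, as the
  \<open>\<tau>\<close> in use is invariant under rotation.\<close>

definition homogeneous3 :: "(nat \<Rightarrow> nat \<Rightarrow> nat \<Rightarrow> real) \<Rightarrow> real \<Rightarrow> nat \<Rightarrow> nat set \<Rightarrow> bool" where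
  "homogeneous3 \<tau> \<sigma> k S \<longleftrightarrow> (\<forall>a\<in>S. \<forall>b\<in>S. \<forall>c\<in>S. a < b \<and> b < c \<longrightarrow> \<tau> (top_bit a b) (top_bit b c) k = \<sigma>)"

lemma dyadic_block_split:
  fixes S :: "nat set"
  assumes "S \<subseteq> {a. a div 2 ^ Suc M = c}"
  obtains S0 S1 where "S = S0 \<union> S1" "S0 \<inter> S1 = {}"
    "S0 \<subseteq> {a. a div 2 ^ M = 2 * c}" "S1 \<subseteq> {a. a div 2 ^ M = 2 * c + 1}"
    "\<And>a b. a \<in> S0 \<Longrightarrow> b \<in> S1 \<Longrightarrow> a < b \<and> top_bit a b = M"
proof
  let ?S0 = "{a \<in> S. a div 2 ^ M = 2 * c}" and ?S1 = "{a \<in> S. a div 2 ^ M = 2 * c + 1}"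
  have half: "a div 2 ^ M div 2 = c" if "a \<in> S" for a
    using assms that by (auto simp: div_mult2_eq[symmetric] mult.commute)
  have "a div 2 ^ M = 2 * c \<or> a div 2 ^ M = 2 * c + 1" if "a \<in> S" for a
  proof -
    have "p = 2 * c \<or> p = 2 * c + 1" if "p div 2 = c" for p
      using that by presburger
    then show ?thesis
      using half[OF that] by blast
  qed
  then show "S = ?S0 \<union> ?S1"
    by blast
  show "a < b \<and> top_bit a b = M" if "a \<in> ?S0" "b \<in> ?S1" for a b
  proof
    show "top_bit a b = M"
      using that assms by (intro top_bit_eqI) auto
    show "a < b"
      using that div_le_mono[of b a "2 ^ M"] by (auto simp: not_less[symmetric])
  qed
qed auto

text \<open>
  Here \<open>k\<close> is the level of an ancestor of the dyadic block that contains \<open>S\<close>. The witnesses in the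
  conclusion record that below a level \<open>j\<close> of \<open>A\<close> the path continues on the left, and on the right for \<open>B\<close>.
\<close>

lemma homogeneous_chain:
  fixes Y Z :: "nat \<Rightarrow> real"
  defines "\<tau> \<equiv> \<lambda>i j l. sgn (det2 Y Z i j l)"
  assumes mono [rule_format]: "\<forall>i j. i < j \<longrightarrow> j \<le> k \<longrightarrow> Y i < Y j"
    and nz [rule_format]: "\<forall>i\<le>k. \<forall>j\<le>k. \<forall>l\<le>k. i \<noteq> j \<longrightarrow> j \<noteq> l \<longrightarrow> i \<noteq> l \<longrightarrow> det2 Y Z i j l \<noteq> 0"
    and "M \<le> k" "finite S" "S \<subseteq> {a. a div 2 ^ M = c}"
    and "homogeneous4 \<tau> \<sigma> S" "homogeneous3 \<tau> \<sigma> k S"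
  shows "\<exists>A B. A \<union> B \<subseteq> {..<M} \<and> card S \<le> card A + card B + 1 \<and>
    (\<forall>i\<in>A \<union> B. \<exists>a\<in>S. \<exists>b\<in>S. a < b \<and> top_bit a b = i) \<and>
    (\<forall>i\<in>A \<union> B. \<forall>j\<in>A. i < j \<longrightarrow>
      (\<exists>a\<in>S. \<exists>b\<in>S. \<exists>c\<in>S. a < b \<and> b < c \<and> top_bit a b = i \<and> top_bit b c = j)) \<and>
    (\<forall>i\<in>A \<union> B. \<forall>j\<in>B. i < j \<longrightarrow>
      (\<exists>a\<in>S. \<exists>b\<in>S. \<exists>c\<in>S. a < b \<and> b < c \<and> top_bit a b = j \<and> top_bit b c = i)) \<and>
    (\<forall>i\<in>A \<union> B. \<forall>j\<in>A. \<forall>l\<in>A \<union> B. i < j \<and> j < l \<longrightarrow> \<tau> i j l = \<sigma>) \<and>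
    (\<forall>i\<in>A \<union> B. \<forall>j\<in>B. \<forall>l\<in>A \<union> B. i < j \<and> j < l \<longrightarrow> \<tau> i j l = - \<sigma>)"
  (is "\<exists>A B. ?P M S A B")
  using assms(4-)
proof (induction M arbitrary: S c)
  case 0
  then have "S \<subseteq> {c}" by auto
  then have "card S \<le> 1"
    using card_mono[of "{c}" S] by simp
  then show ?case by (intro exI[of _ "{}"]) auto
next
  case (Suc M)
  have swap: "\<tau> j i l = - \<tau> i j l" and rot: "\<tau> l i j = \<tau> i j l" for i j l
    by (simp_all add: \<tau>_def det2_swap12[of Y Z j i l] det2_rotate[of Y Z l i j] sgn_minus)
  obtain S0 S1 where S: "S = S0 \<union> S1" "S0 \<inter> S1 = {}"
    "S0 \<subseteq> {a. a div 2 ^ M = 2 * c}" "S1 \<subseteq> {a. a div 2 ^ M = 2 * c + 1}"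
    and cross: "\<And>a b. a \<in> S0 \<Longrightarrow> b \<in> S1 \<Longrightarrow> a < b \<and> top_bit a b = M"
    using dyadic_block_split[OF Suc.prems(3)] by blast
  have fin: "finite S0" "finite S1"
    using Suc.prems(2) S(1) by auto
  have H4: "\<tau> (top_bit a b) (top_bit b c) (top_bit c d) = \<sigma>"
    if "a \<in> S" "b \<in> S" "c \<in> S" "d \<in> S" "a < b" "b < c" "c < d" "top_bit a b \<noteq> top_bit c d" for a b c d
    using Suc.prems(4) that unfolding homogeneous4_def by blast
  have H3: "\<tau> (top_bit a b) (top_bit b c) k = \<sigma>"
    if "a \<in> S" "b \<in> S" "c \<in> S" "a < b" "b < c" for a b c
    using Suc.prems(5) that unfolding homogeneous3_def by blast
  have IH0: "\<exists>A B. ?P M S0 A B" and IH1: "\<exists>A B. ?P M S1 A B"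
    using Suc.prems S fin
    by (intro Suc.IH; auto simp: homogeneous4_def homogeneous3_def)+
  have lt0: "top_bit a b < M" if "a \<in> S0" "b \<in> S0" "a < b" for a b
    using that subsetD[OF S(3), of a] subsetD[OF S(3), of b] by (intro top_bit_less) auto
  have lt1: "top_bit a b < M" if "a \<in> S1" "b \<in> S1" "a < b" for a b
    using that subsetD[OF S(4), of a] subsetD[OF S(4), of b] by (intro top_bit_less) auto
  \<comment> \<open>Two points in each half would give levels \<open>u\<close> and \<open>w\<close>
    such that \<open>\<tau>\<close> is \<sigma> on \<open>u M k\<close>, \<open>M w k\<close> and
    \<open>u M w\<close>, against the three-term relation.\<close>
  have "\<not> (\<exists>a\<in>S0. \<exists>b\<in>S0. \<exists>c\<in>S1. \<exists>d\<in>S1. a < b \<and> c < d)"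
  proof (intro notI, elim bexE conjE)
    fix a b c d assume h: "a \<in> S0" "b \<in> S0" "c \<in> S1" "d \<in> S1" "a < b" "c < d"
    define u w where "u = top_bit a b" and "w = top_bit c d"
    have uw: "u < M" "w < M" "M < k"
      using lt0[of a b] lt1[of c d] h Suc.prems(1) by (auto simp: u_def w_def)
    have bc: "b < c" "top_bit b c = M"
      using cross h by auto
    have 1: "\<tau> u M k = \<sigma>"
      using H3[of a b c] h bc S(1) by (auto simp: u_def)
    have 2: "\<tau> M w k = \<sigma>"
      using H3[of b c d] h bc S(1) by (auto simp: w_def)
    have "det2 Y Z u M k \<noteq> 0"
      using uw by (intro nz) auto
    then have \<sigma>: "\<sigma> \<noteq> 0"
      using 1 by (auto simp: \<tau>_def sgn_0_0)
    \<comment> \<open>For equal levels, \<open>\<tau> u M k\<close> and \<open>\<tau> M w k\<close>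
      would be opposite and nonzero. The inequality is needed since \<open>homogeneous4\<close> is
      silent on equal outer levels.\<close>
    have "u \<noteq> w"
      using 1 2 swap[of M w k] \<sigma> by auto
    then have 3: "\<tau> u M w = \<sigma>"
      using H4[of a b c d] h bc S(1) by (auto simp: u_def w_def)
    have pos: "Y M - Y w > 0" "Y M - Y u > 0" "Y k - Y M > 0"
      using mono[of w M] mono[of u M] mono[of M k] uw by auto
    have "sgn (det2 Y Z u M k * (Y M - Y w)) = \<sigma>" "sgn (det2 Y Z M w k * (Y M - Y u)) = \<sigma>"
      "sgn (det2 Y Z u M w * (Y k - Y M)) = \<sigma>"
      using 1 2 3 pos by (auto simp: \<tau>_def sgn_mult)
    moreover have "x + y + z \<noteq> 0" if "sgn x = \<sigma>" "sgn y = \<sigma>" "sgn z = \<sigma>" for x y z :: real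
      using that \<sigma> by (auto simp: sgn_if split: if_splits)
    ultimately show False
      using det2_plucker_cross[of Y Z u M k w] by blast
  qed
  then have single: "(\<forall>a\<in>S0. \<forall>b\<in>S0. a = b) \<or> (\<forall>a\<in>S1. \<forall>b\<in>S1. a = b)"
    by (meson linorder_less_linear)
  consider "S0 = {}" | "S1 = {}" | "S0 \<noteq> {}" "S1 \<noteq> {}" by blast
  then show ?case
  proof cases
    case 1
    then have "S = S1"
      using S(1) by simp
    then obtain A B where AB: "?P M S A B"
      using IH1 by (elim exE) (rule that, simp only:)
    then have "A \<union> B \<subseteq> {..<Suc M}"
      by auto
    from conjI[OF this conjunct2[OF AB]] show ?thesis
      by (intro exI)
  next
    case 2
    then have "S = S0"
      using S(1) by simp
    then obtain A B where AB: "?P M S A B"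
      using IH0 by (elim exE) (rule that, simp only:)
    then have "A \<union> B \<subseteq> {..<Suc M}"
      by auto
    from conjI[OF this conjunct2[OF AB]] show ?thesis
      by (intro exI)
  next
    case 3
    from 3 obtain x y where "x \<in> S0" "y \<in> S1" by blast
    then have "S0 = {x} \<or> S1 = {y}"
      using single by auto
    then consider a where "S0 = {a}" | d where "S1 = {d}" by blast
    then show ?thesis
    proof cases
      \<comment> \<open>The right half is the single leaf \<open>d\<close>; the path continues on
        the left and \<open>M\<close> joins \<open>A\<close>.\<close>
      case (2 d)
      obtain A B where AB: "?P M S0 A B"
        using IH0 by (elim exE) (rule that)
      note sub = AB[THEN conjunct1] and cardAB = AB[THEN conjunct2, THEN conjunct1]
        and W0 = AB[THEN conjunct2, THEN conjunct2, THEN conjunct1]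
        and WA = AB[THEN conjunct2, THEN conjunct2, THEN conjunct2, THEN conjunct1]
        and WB = AB[THEN conjunct2, THEN conjunct2, THEN conjunct2, THEN conjunct2, THEN conjunct1]
        and TA = AB[THEN conjunct2, THEN conjunct2, THEN conjunct2, THEN conjunct2, THEN conjunct2, THEN conjunct1]
        and TB = AB[THEN conjunct2, THEN conjunct2, THEN conjunct2, THEN conjunct2, THEN conjunct2, THEN conjunct2]
      have M: "M \<notin> A" "finite A" "finite B"
        using sub by (auto intro: finite_subset[of _ "{..<M}"])
      have ltM: "i < M" if "i \<in> A \<union> B" for i
        using that sub by blast
      \<comment> \<open>Appending \<open>d\<close> turns the witness triple into a quadruple with
        third level \<open>M\<close>.\<close>
      have new: "\<tau> i j M = \<sigma>" if "i \<in> A \<union> B" "j \<in> A" "i < j" for i j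
      proof -
        from WA[rule_format, OF that] obtain x y z where "x \<in> S0" "y \<in> S0" "z \<in> S0" "x < y" "y < z" "top_bit x y = i" "top_bit y z = j"
          by blast
        then show ?thesis
          using H4[of x y z d] cross[of z d] 2 S(1) ltM[OF that(1)] by auto
      qed
      \<comment> \<open>Below a level of \<open>B\<close> the path continues on the right, so
        \<open>j\<close> comes before \<open>i\<close> in the witness; the swap produces the minus
        sign.\<close>
      have new': "\<tau> i j M = - \<sigma>" if "i \<in> A \<union> B" "j \<in> B" "i < j" for i j
      proof -
        from WB[rule_format, OF that] obtain x y z where "x \<in> S0" "y \<in> S0" "z \<in> S0" "x < y" "y < z" "top_bit x y = j" "top_bit y z = i"
          by blast
        then have "\<tau> j i M = \<sigma>"
          using H4[of x y z d] cross[of z d] 2 S(1) ltM[of j] that by auto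
        then show ?thesis
          using swap[of j i M] by simp
      qed
      show ?thesis
      proof (rule exI[of _ "insert M A"], rule exI[of _ B], intro conjI)
        show "insert M A \<union> B \<subseteq> {..<Suc M}"
          using sub by auto
        show "card S \<le> card (insert M A) + card B + 1"
          using cardAB M S(1,2) fin 2 by (simp add: card_Un_disjoint)
        show "\<forall>i\<in>insert M A \<union> B. \<exists>a\<in>S. \<exists>b\<in>S. a < b \<and> top_bit a b = i"
          using W0 cross 3 S(1) by blast
        show "\<forall>i\<in>insert M A \<union> B. \<forall>j\<in>insert M A. i < j \<longrightarrow>
          (\<exists>a\<in>S. \<exists>b\<in>S. \<exists>c\<in>S. a < b \<and> b < c \<and> top_bit a b = i \<and> top_bit b c = j)"
        proof (intro ballI impI)
          fix i j assume ij: "i \<in> insert M A \<union> B" "j \<in> insert M A" "i < j"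
          then have i: "i \<in> A \<union> B"
            using ltM[of j] by auto
          show "\<exists>a\<in>S. \<exists>b\<in>S. \<exists>c\<in>S. a < b \<and> b < c \<and> top_bit a b = i \<and> top_bit b c = j"
          proof (cases "j = M")
            case True
            from W0[rule_format, OF i] obtain a b where "a \<in> S0" "b \<in> S0" "a < b" "top_bit a b = i"
              by blast
            then show ?thesis
              using cross[of b d] 2 S(1) True by blast
          next
            case False
            then show ?thesis
              using WA i ij S(1) by blast
          qed
        qed
        show "\<forall>i\<in>insert M A \<union> B. \<forall>j\<in>B. i < j \<longrightarrow>
          (\<exists>a\<in>S. \<exists>b\<in>S. \<exists>c\<in>S. a < b \<and> b < c \<and> top_bit a b = j \<and> top_bit b c = i)"
        proof (intro ballI impI)
          fix i j assume ij: "i \<in> insert M A \<union> B" "j \<in> B" "i < j"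
          then have "i \<in> A \<union> B"
            using ltM[of j] by auto
          then show "\<exists>a\<in>S. \<exists>b\<in>S. \<exists>c\<in>S. a < b \<and> b < c \<and> top_bit a b = j \<and> top_bit b c = i"
            using WB ij S(1) by blast
        qed
        show "\<forall>i\<in>insert M A \<union> B. \<forall>j\<in>insert M A. \<forall>l\<in>insert M A \<union> B. i < j \<and> j < l \<longrightarrow> \<tau> i j l = \<sigma>"
        proof (intro ballI impI)
          fix i j l assume h: "i \<in> insert M A \<union> B" "j \<in> insert M A" "l \<in> insert M A \<union> B" "i < j \<and> j < l"
          then have "i \<in> A \<union> B" "j \<in> A"
            using ltM[of j] ltM[of l] by auto
          then show "\<tau> i j l = \<sigma>"
            using TA h new by blast
        qed
        show "\<forall>i\<in>insert M A \<union> B. \<forall>j\<in>B. \<forall>l\<in>insert M A \<union> B. i < j \<and> j < l \<longrightarrow> \<tau> i j l = - \<sigma>"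
        proof (intro ballI impI)
          fix i j l assume h: "i \<in> insert M A \<union> B" "j \<in> B" "l \<in> insert M A \<union> B" "i < j \<and> j < l"
          then have "i \<in> A \<union> B"
            using ltM[of j] ltM[of l] by auto
          then show "\<tau> i j l = - \<sigma>"
            using TB h new' by blast
        qed
      qed
    next
      \<comment> \<open>The left half is the single leaf \<open>d\<close>, and \<open>M\<close>
        joins \<open>B\<close>. As \<open>d\<close> precedes the block, \<open>M\<close> occurs as
        the first level, and \<open>rot\<close> moves it to the end.\<close>
      case (1 d)
      obtain A B where AB: "?P M S1 A B"
        using IH1 by (elim exE) (rule that)
      note sub = AB[THEN conjunct1] and cardAB = AB[THEN conjunct2, THEN conjunct1]
        and W0 = AB[THEN conjunct2, THEN conjunct2, THEN conjunct1]
        and WA = AB[THEN conjunct2, THEN conjunct2, THEN conjunct2, THEN conjunct1]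
        and WB = AB[THEN conjunct2, THEN conjunct2, THEN conjunct2, THEN conjunct2, THEN conjunct1]
        and TA = AB[THEN conjunct2, THEN conjunct2, THEN conjunct2, THEN conjunct2, THEN conjunct2, THEN conjunct1]
        and TB = AB[THEN conjunct2, THEN conjunct2, THEN conjunct2, THEN conjunct2, THEN conjunct2, THEN conjunct2]
      have M: "M \<notin> B" "finite A" "finite B"
        using sub by (auto intro: finite_subset[of _ "{..<M}"])
      have ltM: "i < M" if "i \<in> A \<union> B" for i
        using that sub by blast
      have new: "\<tau> i j M = \<sigma>" if "i \<in> A \<union> B" "j \<in> A" "i < j" for i j
      proof -
        from WA[rule_format, OF that] obtain x y z where "x \<in> S1" "y \<in> S1" "z \<in> S1" "x < y" "y < z" "top_bit x y = i" "top_bit y z = j"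
          by blast
        then show ?thesis
          using H4[of d x y z] cross[of d x] 1 S(1) ltM[of j] that rot[of M i j] by auto
      qed
      have new': "\<tau> i j M = - \<sigma>" if "i \<in> A \<union> B" "j \<in> B" "i < j" for i j
      proof -
        from WB[rule_format, OF that] obtain x y z where "x \<in> S1" "y \<in> S1" "z \<in> S1" "x < y" "y < z" "top_bit x y = j" "top_bit y z = i"
          by blast
        then have "\<tau> j i M = \<sigma>"
          using H4[of d x y z] cross[of d x] 1 S(1) ltM[of i] that rot[of M j i] by auto
        then show ?thesis
          using swap[of j i M] by simp
      qed
      show ?thesis
      proof (rule exI[of _ A], rule exI[of _ "insert M B"], intro conjI)
        show "A \<union> insert M B \<subseteq> {..<Suc M}"
          using sub by auto
        show "card S \<le> card A + card (insert M B) + 1"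
          using cardAB M S(1,2) fin 1 by (simp add: card_Un_disjoint)
        show "\<forall>i\<in>A \<union> insert M B. \<exists>a\<in>S. \<exists>b\<in>S. a < b \<and> top_bit a b = i"
          using W0 cross 3 S(1) by blast
        show "\<forall>i\<in>A \<union> insert M B. \<forall>j\<in>insert M B. i < j \<longrightarrow>
          (\<exists>a\<in>S. \<exists>b\<in>S. \<exists>c\<in>S. a < b \<and> b < c \<and> top_bit a b = j \<and> top_bit b c = i)"
        proof (intro ballI impI)
          fix i j assume ij: "i \<in> A \<union> insert M B" "j \<in> insert M B" "i < j"
          then have i: "i \<in> A \<union> B"
            using ltM[of j] by auto
          show "\<exists>a\<in>S. \<exists>b\<in>S. \<exists>c\<in>S. a < b \<and> b < c \<and> top_bit a b = j \<and> top_bit b c = i"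
          proof (cases "j = M")
            case True
            from W0[rule_format, OF i] obtain a b where "a \<in> S1" "b \<in> S1" "a < b" "top_bit a b = i"
              by blast
            then show ?thesis
              using cross[of d a] 1 S(1) True by blast
          next
            case False
            then show ?thesis
              using WB i ij S(1) by blast
          qed
        qed
        show "\<forall>i\<in>A \<union> insert M B. \<forall>j\<in>A. i < j \<longrightarrow>
          (\<exists>a\<in>S. \<exists>b\<in>S. \<exists>c\<in>S. a < b \<and> b < c \<and> top_bit a b = i \<and> top_bit b c = j)"
        proof (intro ballI impI)
          fix i j assume ij: "i \<in> A \<union> insert M B" "j \<in> A" "i < j"
          then have "i \<in> A \<union> B"
            using ltM[of j] by auto
          then show "\<exists>a\<in>S. \<exists>b\<in>S. \<exists>c\<in>S. a < b \<and> b < c \<and> top_bit a b = i \<and> top_bit b c = j"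
            using WA ij S(1) by blast
        qed
        show "\<forall>i\<in>A \<union> insert M B. \<forall>j\<in>A. \<forall>l\<in>A \<union> insert M B. i < j \<and> j < l \<longrightarrow> \<tau> i j l = \<sigma>"
        proof (intro ballI impI)
          fix i j l assume h: "i \<in> A \<union> insert M B" "j \<in> A" "l \<in> A \<union> insert M B" "i < j \<and> j < l"
          then have "i \<in> A \<union> B"
            using ltM[of j] ltM[of l] by auto
          then show "\<tau> i j l = \<sigma>"
            using TA h new by blast
        qed
        show "\<forall>i\<in>A \<union> insert M B. \<forall>j\<in>insert M B. \<forall>l\<in>A \<union> insert M B. i < j \<and> j < l \<longrightarrow> \<tau> i j l = - \<sigma>"
        proof (intro ballI impI)
          fix i j l assume h: "i \<in> A \<union> insert M B" "j \<in> insert M B" "l \<in> A \<union> insert M B" "i < j \<and> j < l"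
          then have "i \<in> A \<union> B" "j \<in> B"
            using ltM[of j] ltM[of l] by auto
          then show "\<tau> i j l = - \<sigma>"
            using TB h new' by blast
        qed
      qed
    qed
  qed
qed

text \<open>Descend to the first level where both halves contain points. Passing to the larger half,
  and there to the larger of the sets \<open>A\<close> and \<open>B\<close> of the chain, costs a
  factor 2 each; the one extra leaf of the chain counts twice.\<close>

lemma homogeneous_levels:
  fixes Y Z :: "nat \<Rightarrow> real"
  defines "\<tau> \<equiv> \<lambda>i j l. sgn (det2 Y Z i j l)"
  assumes mono: "\<And>i j. i < j \<Longrightarrow> j < N \<Longrightarrow> Y i < Y j"
    and nz: "\<And>i j l. i < N \<Longrightarrow> j < N \<Longrightarrow> l < N \<Longrightarrow> i \<noteq> j \<Longrightarrow> j \<noteq> l \<Longrightarrow> i \<noteq> l \<Longrightarrow> det2 Y Z i j l \<noteq> 0"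
    and "M \<le> N" "finite S" "S \<subseteq> {a. a div 2 ^ M = c}" "homogeneous4 \<tau> \<sigma> S"
  shows "\<exists>A\<subseteq>{..<M}. card S \<le> 4 * card A + 2 \<and>
    (\<exists>s. \<forall>i\<in>A. \<forall>j\<in>A. \<forall>l\<in>A. i < j \<and> j < l \<longrightarrow> \<tau> i j l = s)"
  using assms(4-)
proof (induction M arbitrary: S c)
  case 0
  then have "S \<subseteq> {c}" by auto
  then have "card S \<le> 1"
    using card_mono[of "{c}" S] by simp
  then show ?case by (intro exI[of _ "{}"]) auto
next
  case (Suc M)
  obtain S0 S1 where S: "S = S0 \<union> S1" "S0 \<inter> S1 = {}"
    "S0 \<subseteq> {a. a div 2 ^ M = 2 * c}" "S1 \<subseteq> {a. a div 2 ^ M = 2 * c + 1}"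
    and cross: "\<And>a b. a \<in> S0 \<Longrightarrow> b \<in> S1 \<Longrightarrow> a < b \<and> top_bit a b = M"
    using dyadic_block_split[OF Suc.prems(3)] by blast
  have fin: "finite S0" "finite S1"
    using Suc.prems(2) S(1) by auto
  have H4: "homogeneous4 \<tau> \<sigma> S0" "homogeneous4 \<tau> \<sigma> S1"
    using Suc.prems(4) S(1) by (auto simp: homogeneous4_def)
  have rot: "\<tau> l i j = \<tau> i j l" for i j l
    by (simp add: \<tau>_def det2_rotate[of Y Z l i j])
  show ?case
  proof (cases "S0 = {} \<or> S1 = {}")
    case True
    have "\<exists>A\<subseteq>{..<M}. card S \<le> 4 * card A + 2 \<and>
        (\<exists>s. \<forall>i\<in>A. \<forall>j\<in>A. \<forall>l\<in>A. i < j \<and> j < l \<longrightarrow> \<tau> i j l = s)"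
      using True
    proof
      assume "S0 = {}"
      then show ?thesis
        using Suc.IH[of S1 "2 * c + 1"] Suc.prems(1) fin S H4 by simp
    next
      assume "S1 = {}"
      then show ?thesis
        using Suc.IH[of S0 "2 * c"] Suc.prems(1) fin S H4 by simp
    qed
    then show ?thesis
      by (elim exE conjE) (rule exI, rule conjI[rotated], rule conjI, assumption, blast, auto)
  next
    case False
    have lt: "top_bit a b < M" if "a \<in> S0 \<and> b \<in> S0 \<or> a \<in> S1 \<and> b \<in> S1" "a < b" for a b
    proof -
      have "a div 2 ^ M = b div 2 ^ M"
        using that(1) subsetD[OF S(3), of a] subsetD[OF S(3), of b] subsetD[OF S(4), of a] subsetD[OF S(4), of b]
        by auto
      then show ?thesis
        using that(2) by (intro top_bit_less) auto
    qed
    \<comment> \<open>A point of the opposite half serves as fourth point for \<open>S0\<close> and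
      as first point for \<open>S1\<close>.\<close>
    have H3: "homogeneous3 \<tau> \<sigma> M S0" "homogeneous3 \<tau> \<sigma> M S1"
      unfolding homogeneous3_def
    proof (safe, goal_cases)
      case (1 x y z)
      obtain d where "d \<in> S1" using False by blast
      then show ?case
        using Suc.prems(4) 1 cross[of z d] S(1) lt[of x y] unfolding homogeneous4_def by force
    next
      case (2 x y z)
      obtain d where "d \<in> S0" using False by blast
      then have "\<tau> M (top_bit x y) (top_bit y z) = \<sigma>"
        using Suc.prems(4) 2 cross[of d x] S(1) lt[of y z] unfolding homogeneous4_def by force
      then show ?case
        using rot[of M "top_bit x y" "top_bit y z"] by simp
    qed
    have "\<exists>T c. T \<subseteq> S \<and> T \<subseteq> {a. a div 2 ^ M = c} \<and> card S \<le> 2 * card T \<and> homogeneous4 \<tau> \<sigma> T \<and> homogeneous3 \<tau> \<sigma> M T"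
    proof (cases "card S0 \<le> card S1")
      case True
      then show ?thesis
        using S H3 H4 fin by (intro exI[of _ S1] exI[of _ "2 * c + 1"]) (auto simp: card_Un_disjoint)
    next
      case False
      then show ?thesis
        using S H3 H4 fin by (intro exI[of _ S0] exI[of _ "2 * c"]) (auto simp: card_Un_disjoint)
    qed
    then obtain T c' where T: "T \<subseteq> S" "T \<subseteq> {a. a div 2 ^ M = c'}" "card S \<le> 2 * card T"
      "homogeneous4 \<tau> \<sigma> T" "homogeneous3 \<tau> \<sigma> M T"
      by blast
    have finT: "finite T"
      using T(1) Suc.prems(2) finite_subset by blast
    have mono': "\<forall>i j. i < j \<longrightarrow> j \<le> M \<longrightarrow> Y i < Y j"
      using Suc.prems(1) by (intro allI impI mono) auto
    have nz': "\<forall>i\<le>M. \<forall>j\<le>M. \<forall>l\<le>M. i \<noteq> j \<longrightarrow> j \<noteq> l \<longrightarrow> i \<noteq> l \<longrightarrow> det2 Y Z i j l \<noteq> 0"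
      using Suc.prems(1) by (intro allI impI nz) auto
    from homogeneous_chain[of M Y Z M T c' \<sigma>, OF mono' nz' order_refl finT T(2) T(4,5)[unfolded \<tau>_def]]
    obtain A B where AB: "A \<union> B \<subseteq> {..<M}" "card T \<le> card A + card B + 1"
      and TA: "\<forall>i\<in>A \<union> B. \<forall>j\<in>A. \<forall>l\<in>A \<union> B. i < j \<and> j < l \<longrightarrow> sgn (det2 Y Z i j l) = \<sigma>"
      and TB: "\<forall>i\<in>A \<union> B. \<forall>j\<in>B. \<forall>l\<in>A \<union> B. i < j \<and> j < l \<longrightarrow> sgn (det2 Y Z i j l) = - \<sigma>"
      by (elim exE conjE) (rule that)
    show ?thesis
    proof (cases "card A \<le> card B")
      case True
      then have "card S \<le> 4 * card B + 2"
        using AB(2) T(3) by simp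
      moreover have "\<forall>i\<in>B. \<forall>j\<in>B. \<forall>l\<in>B. i < j \<and> j < l \<longrightarrow> \<tau> i j l = - \<sigma>"
        using TB unfolding \<tau>_def by blast
      ultimately show ?thesis
        using AB(1) by (intro exI[of _ B]) auto
    next
      case False
      then have "card S \<le> 4 * card A + 2"
        using AB(2) T(3) by simp
      moreover have "\<forall>i\<in>A. \<forall>j\<in>A. \<forall>l\<in>A. i < j \<and> j < l \<longrightarrow> \<tau> i j l = \<sigma>"
        using TA unfolding \<tau>_def by blast
      ultimately show ?thesis
        using AB(1) by (intro exI[of _ A]) auto
    qed
  qed
qed

section \<open>The lower bound\<close>

definition bit_sum :: "nat \<Rightarrow> (nat \<Rightarrow> real) \<Rightarrow> nat \<Rightarrow> real \<Rightarrow> real" where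
  "bit_sum M w a t = (\<Sum>i<M. of_bool (odd (a div 2 ^ i)) * t ^ i * w i)"

text \<open>Digits above the top bit cancel, the top bit contributes its weight with coefficient 1,
  and lower powers of \<open>t\<close> become negligible.\<close>

lemma bit_sum_diff_limit:
  assumes "a < b" "b < 2 ^ M"
  shows "((\<lambda>t. (bit_sum M w b t - bit_sum M w a t) / t ^ top_bit a b) \<longlongrightarrow> w (top_bit a b)) at_top"
proof -
  let ?d = "top_bit a b"
  define e :: "nat \<Rightarrow> real" where "e i = of_bool (odd (b div 2 ^ i)) - of_bool (odd (a div 2 ^ i))" for i
  have d: "?d < M"
    using assms by (intro top_bit_less) auto
  have e0: "e i = 0" if "?d < i" for i
    using top_bit_split(3)[OF assms(1) that] by (simp add: e_def)
  have e1: "e ?d = 1"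
    using top_bit_split(1,2)[OF assms(1)] by (simp add: e_def)
  have "((\<lambda>t. e i * w i * (t ^ i / t ^ ?d)) \<longlongrightarrow> (if i = ?d then w ?d else 0)) at_top" for i
  proof -
    consider "i < ?d" | "i = ?d" | "?d < i" by linarith
    then show ?thesis
    proof cases
      case 1
      then have "((\<lambda>t::real. inverse (t ^ (?d - i))) \<longlongrightarrow> 0) at_top"
        by (intro tendsto_inverse_0_at_top filterlim_pow_at_top filterlim_ident) auto
      moreover have "\<forall>\<^sub>F t in at_top. inverse (t ^ (?d - i)) = t ^ i / (t::real) ^ ?d"
        using eventually_gt_at_top[of 0]
        by eventually_elim (use 1 in \<open>simp add: power_diff field_simps\<close>)
      ultimately have "((\<lambda>t::real. t ^ i / t ^ ?d) \<longlongrightarrow> 0) at_top"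
        by (rule Lim_transform_eventually)
      then have "((\<lambda>t. e i * w i * (t ^ i / t ^ ?d)) \<longlongrightarrow> e i * w i * 0) at_top"
        by (intro tendsto_intros)
      then show ?thesis using 1 by simp
    next
      case 2
      have "\<forall>\<^sub>F t in at_top. w ?d = e i * w i * (t ^ i / (t::real) ^ ?d)"
        using eventually_gt_at_top[of 0]
        by eventually_elim (use 2 e1 in simp)
      then have "((\<lambda>t. e i * w i * (t ^ i / t ^ ?d)) \<longlongrightarrow> w ?d) at_top"
        by (rule Lim_transform_eventually[OF tendsto_const])
      then show ?thesis
        by (simp only: 2 if_True simp_thms)
    qed (use e0 in simp)
  qed
  then have "((\<lambda>t. \<Sum>i<M. e i * w i * (t ^ i / t ^ ?d)) \<longlongrightarrow> (\<Sum>i<M. if i = ?d then w ?d else 0)) at_top"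
    by (intro tendsto_sum) auto
  moreover have "(\<Sum>i<M. if i = ?d then w ?d else 0) = w ?d"
    using d by simp
  moreover have "(\<Sum>i<M. e i * w i * (t ^ i / t ^ ?d)) = (bit_sum M w b t - bit_sum M w a t) / t ^ ?d" for t
    by (simp add: bit_sum_def e_def sum_subtractf[symmetric] sum_divide_distrib algebra_simps diff_divide_distrib)
  ultimately show ?thesis
    by simp
qed

lemma eventually_sgn_eq_limit:
  fixes f :: "'a \<Rightarrow> real"
  assumes "(f \<longlongrightarrow> l) F" "l \<noteq> 0"
  shows "\<forall>\<^sub>F x in F. sgn (f x) = sgn l"
proof (cases "l > 0")
  case True
  then show ?thesis
    using order_tendstoD(1)[OF assms(1), of 0] by (auto elim: eventually_mono)
next
  case False
  then show ?thesis
    using order_tendstoD(2)[OF assms(1), of 0] assms(2) by (auto elim: eventually_mono)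
qed

text \<open>With weights 1 and \<open>i\<close>, the rescaled edge from \<open>a\<close> to
  \<open>b\<close> tends to the vector (1, \<open>top_bit a b\<close>), so its slope is
  asymptotically a level. The turn at \<open>b\<close> compares two levels, distinct by
  \<open>top_bit_neq\<close>. A large \<open>t\<close> serves all of the finitely many
  triples.\<close>

lemma planar_configuration:
  "\<exists>Y Z :: nat \<Rightarrow> real. (\<forall>a<2 ^ K. \<forall>b<2 ^ K. a < b \<longrightarrow> Y a < Y b) \<and>
     (\<forall>a<2 ^ K. \<forall>b<2 ^ K. \<forall>c<2 ^ K. a < b \<and> b < c \<longrightarrow>
        sgn (det2 Y Z a b c) = sgn (real (top_bit b c) - real (top_bit a b)))"
proof -
  define Y where "Y t a = bit_sum K (\<lambda>_. 1) a t" for t a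
  define Z where "Z t a = bit_sum K real a t" for t a
  have limY: "((\<lambda>t. (Y t b - Y t a) / t ^ top_bit a b) \<longlongrightarrow> 1) at_top"
    and limZ: "((\<lambda>t. (Z t b - Z t a) / t ^ top_bit a b) \<longlongrightarrow> real (top_bit a b)) at_top"
    if "a < b" "b < 2 ^ K" for a b
    unfolding Y_def Z_def using bit_sum_diff_limit[OF that, of "\<lambda>_. 1"] bit_sum_diff_limit[OF that, of real] by auto
  have "\<forall>\<^sub>F t in at_top. a < b \<longrightarrow> Y t a < Y t b" if "b \<in> {..<2 ^ K}" for a b
  proof (cases "a < b")
    case True
    have "\<forall>\<^sub>F t in at_top. sgn ((Y t b - Y t a) / t ^ top_bit a b) = sgn 1"
      using True that by (intro eventually_sgn_eq_limit limY) auto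
    then show ?thesis
      using eventually_gt_at_top[of 0]
      by eventually_elim (auto simp: sgn_if zero_less_divide_iff split: if_splits)
  qed (rule always_eventually, blast)
  then have 1: "\<forall>\<^sub>F t in at_top. \<forall>a\<in>{..<2 ^ K}. \<forall>b\<in>{..<2 ^ K}. a < b \<longrightarrow> Y t a < Y t b"
    by (intro eventually_ball_finite ballI) auto
  have "\<forall>\<^sub>F t in at_top. a < b \<and> b < c \<longrightarrow>
      sgn (det2 (Y t) (Z t) a b c) = sgn (real (top_bit b c) - real (top_bit a b))"
    if "c \<in> {..<2 ^ K}" for a b c
  proof (cases "a < b \<and> b < c")
    case True
    then have lt: "a < b" "b < c" "b < 2 ^ K" "c < 2 ^ K"
      using that by auto
    let ?n = "\<lambda>W a b t. (W t b - W t a) / t ^ top_bit a b"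
    have "((\<lambda>t. ?n Y a b t * ?n Z b c t - ?n Y b c t * ?n Z a b t) \<longlongrightarrow>
        1 * real (top_bit b c) - 1 * real (top_bit a b)) at_top"
      using lt by (intro tendsto_intros limY limZ)
    then have "\<forall>\<^sub>F t in at_top. sgn (?n Y a b t * ?n Z b c t - ?n Y b c t * ?n Z a b t) =
        sgn (1 * real (top_bit b c) - 1 * real (top_bit a b))"
      using top_bit_neq[OF lt(1,2)] by (intro eventually_sgn_eq_limit) auto
    then show ?thesis
      using eventually_gt_at_top[of 0]
    proof eventually_elim
      case (elim t)
      have "?n Y a b t * ?n Z b c t - ?n Y b c t * ?n Z a b t =
          det2 (Y t) (Z t) a b c / (t ^ top_bit a b * t ^ top_bit b c)"
        using elim(2) by (simp add: det2_def field_simps)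
      then show ?case
        using elim by (simp add: sgn_divide sgn_mult)
    qed
  qed (rule always_eventually, blast)
  then have 2: "\<forall>\<^sub>F t in at_top. \<forall>a\<in>{..<2 ^ K}. \<forall>b\<in>{..<2 ^ K}. \<forall>c\<in>{..<2 ^ K}. a < b \<and> b < c \<longrightarrow>
      sgn (det2 (Y t) (Z t) a b c) = sgn (real (top_bit b c) - real (top_bit a b))"
    by (intro eventually_ball_finite ballI) auto
  obtain t where "\<forall>a\<in>{..<2 ^ K}. \<forall>b\<in>{..<2 ^ K}. a < b \<longrightarrow> Y t a < Y t b"
    "\<forall>a\<in>{..<2 ^ K}. \<forall>b\<in>{..<2 ^ K}. \<forall>c\<in>{..<2 ^ K}. a < b \<and> b < c \<longrightarrow>
      sgn (det2 (Y t) (Z t) a b c) = sgn (real (top_bit b c) - real (top_bit a b))"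
    using eventually_happens'[OF _ eventually_conj[OF 1 2]] by auto
  then show ?thesis
    by (intro exI[of _ "Y t"] exI[of _ "Z t"]) auto
qed

lemma tendsto_det3:
  assumes "\<And>k. ((\<lambda>x. u x $ k) \<longlongrightarrow> u0 $ k) F" "\<And>k. ((\<lambda>x. v x $ k) \<longlongrightarrow> v0 $ k) F"
    "\<And>k. ((\<lambda>x. w x $ k) \<longlongrightarrow> w0 $ k) F"
  shows "((\<lambda>x. det3 (u x) (v x) (w x)) \<longlongrightarrow> det3 u0 v0 w0) F"
  unfolding det3_def by (intro tendsto_intros assms)

text \<open>Consecutive differences replace those from \<open>a\<close>, so that each vector has its
  own dominant power of \<open>t\<close>.\<close>

lemma det3_telescope: "det3 (b - a) (c - a) (d - a) = det3 (b - a) (c - b) (d - c)"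
  by (simp add: det3_def algebra_simps)

lemma det3_lift: "det3 (vector [1, Y i, Z i]) (vector [1, Y j, Z j]) (vector [1, Y l, Z l]) = det2 Y Z i j l"
  by (simp add: det3_def det2_def algebra_simps)

text \<open>The rescaled consecutive differences tend to the vectors \<open>W\<close> at their top
  bits, hence the determinant tends to \<open>det2\<close> of these levels. Neighbouring top bits
  differ anyway; equal outer ones would give the limit 0 and no information on the sign.\<close>

lemma lifted_configuration:
  fixes Y Z :: "nat \<Rightarrow> real"
  assumes nz [rule_format]: "\<forall>i<M. \<forall>j<M. \<forall>l<M. i \<noteq> j \<longrightarrow> j \<noteq> l \<longrightarrow> i \<noteq> l \<longrightarrow> det2 Y Z i j l \<noteq> 0"
  shows "\<exists>p :: nat \<Rightarrow> real^3. \<forall>a<2 ^ M. \<forall>b<2 ^ M. \<forall>c<2 ^ M. \<forall>d<2 ^ M. a < b \<and> b < c \<and> c < d \<and> top_bit a b \<noteq> top_bit c d \<longrightarrow>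
    sgn (det3 (p b - p a) (p c - p a) (p d - p a)) = sgn (det2 Y Z (top_bit a b) (top_bit b c) (top_bit c d))
    \<and> det3 (p b - p a) (p c - p a) (p d - p a) \<noteq> 0"
proof -
  define W :: "nat \<Rightarrow> real^3" where "W i = vector [1, Y i, Z i]" for i
  define p :: "real \<Rightarrow> nat \<Rightarrow> real^3" where "p t a = (\<chi> k. bit_sum M (\<lambda>i. W i $ k) a t)" for t a
  have lim: "((\<lambda>t. ((1 / t ^ top_bit a b) *\<^sub>R (p t b - p t a)) $ k) \<longlongrightarrow> W (top_bit a b) $ k) at_top"
    if "a < b" "b < 2 ^ M" for a b k
    using bit_sum_diff_limit[OF that, of "\<lambda>i. W i $ k"] by (simp add: p_def)
  have "\<forall>\<^sub>F t in at_top. a < b \<and> b < c \<and> c < d \<and> top_bit a b \<noteq> top_bit c d \<longrightarrow>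
    sgn (det3 (p t b - p t a) (p t c - p t a) (p t d - p t a)) = sgn (det2 Y Z (top_bit a b) (top_bit b c) (top_bit c d))
    \<and> det3 (p t b - p t a) (p t c - p t a) (p t d - p t a) \<noteq> 0"
    if "d \<in> {..<2 ^ M}" for a b c d
  proof (cases "a < b \<and> b < c \<and> c < d \<and> top_bit a b \<noteq> top_bit c d")
    case True
    then have lt: "a < b" "b < c" "c < d" "b < 2 ^ M" "c < 2 ^ M" "d < 2 ^ M"
      using that by auto
    let ?D = "det2 Y Z (top_bit a b) (top_bit b c) (top_bit c d)"
    have D: "?D \<noteq> 0"
      using lt True top_bit_neq[OF lt(1,2)] top_bit_neq[OF lt(2,3)]
      by (intro nz top_bit_less) auto
    have "\<forall>\<^sub>F t in at_top. sgn (det3 ((1 / t ^ top_bit a b) *\<^sub>R (p t b - p t a))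
       ((1 / t ^ top_bit b c) *\<^sub>R (p t c - p t b)) ((1 / t ^ top_bit c d) *\<^sub>R (p t d - p t c))) = sgn ?D"
    proof (rule eventually_sgn_eq_limit[OF _ D])
      show "((\<lambda>t. det3 ((1 / t ^ top_bit a b) *\<^sub>R (p t b - p t a))
         ((1 / t ^ top_bit b c) *\<^sub>R (p t c - p t b)) ((1 / t ^ top_bit c d) *\<^sub>R (p t d - p t c))) \<longlongrightarrow> ?D) at_top"
        unfolding det3_lift[symmetric] W_def[symmetric] using lt by (intro tendsto_det3 lim)
    qed
    then show ?thesis
      using eventually_gt_at_top[of 0]
    proof eventually_elim
      case (elim t)
      then have "sgn (det3 (p t b - p t a) (p t c - p t b) (p t d - p t c)) = sgn ?D"
        unfolding det3_scaleR by (simp add: sgn_mult sgn_divide)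
      then show ?case
        unfolding det3_telescope[of "p t b" "p t a"] using D by (metis sgn_eq_0_iff)
    qed
  qed (rule always_eventually, blast)
  then have "\<forall>\<^sub>F t in at_top. \<forall>a\<in>{..<2 ^ M}. \<forall>b\<in>{..<2 ^ M}. \<forall>c\<in>{..<2 ^ M}. \<forall>d\<in>{..<2 ^ M}.
    a < b \<and> b < c \<and> c < d \<and> top_bit a b \<noteq> top_bit c d \<longrightarrow>
    sgn (det3 (p t b - p t a) (p t c - p t a) (p t d - p t a)) = sgn (det2 Y Z (top_bit a b) (top_bit b c) (top_bit c d))
    \<and> det3 (p t b - p t a) (p t c - p t a) (p t d - p t a) \<noteq> 0"
    by (intro eventually_ball_finite ballI) auto
  then obtain t where "\<forall>a\<in>{..<2 ^ M}. \<forall>b\<in>{..<2 ^ M}. \<forall>c\<in>{..<2 ^ M}. \<forall>d\<in>{..<2 ^ M}.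
    a < b \<and> b < c \<and> c < d \<and> top_bit a b \<noteq> top_bit c d \<longrightarrow>
    sgn (det3 (p t b - p t a) (p t c - p t a) (p t d - p t a)) = sgn (det2 Y Z (top_bit a b) (top_bit b c) (top_bit c d))
    \<and> det3 (p t b - p t a) (p t c - p t a) (p t d - p t a) \<noteq> 0"
    using eventually_happens'[OF trivial_limit_at_top_linorder] by blast
  then show ?thesis
    by (intro exI[of _ "p t"]) (simp only: lessThan_iff Ball_def)
qed

section \<open>Perturbation into general position\<close>

definition moment_curve :: "real \<Rightarrow> real^3" where
  "moment_curve s = vector [s, s ^ 2, s ^ 3]"

text \<open>A Vandermonde product, nonzero for distinct parameters.\<close>

lemma det3_moment_curve:
  "det3 (moment_curve b - moment_curve a) (moment_curve c - moment_curve a) (moment_curve d - moment_curve a) =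
    (b - a) * (c - a) * (d - a) * (c - b) * (d - b) * (d - c)"
  by (simp add: det3_def moment_curve_def power2_eq_square power3_eq_cube algebra_simps)

text \<open>The determinant is a cubic polynomial in \<open>\<epsilon>\<close> with leading
  coefficient \<open>det3 u1 v1 w1\<close>, so it has finitely many roots.\<close>

lemma eventually_det3_perturb_nonzero:
  assumes "det3 u1 v1 w1 \<noteq> 0"
  shows "\<forall>\<^sub>F \<epsilon> in at_right 0. det3 (u0 + \<epsilon> *\<^sub>R u1) (v0 + \<epsilon> *\<^sub>R v1) (w0 + \<epsilon> *\<^sub>R w1) \<noteq> 0"
proof -
  define P where "P = [:det3 u0 v0 w0, det3 u1 v0 w0 + det3 u0 v1 w0 + det3 u0 v0 w1,
    det3 u1 v1 w0 + det3 u1 v0 w1 + det3 u0 v1 w1, det3 u1 v1 w1:]"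
  have P: "det3 (u0 + \<epsilon> *\<^sub>R u1) (v0 + \<epsilon> *\<^sub>R v1) (w0 + \<epsilon> *\<^sub>R w1) = poly P \<epsilon>" for \<epsilon>
    by (simp add: P_def det3_def algebra_simps)
  have "P \<noteq> 0"
    using assms by (simp add: P_def)
  then have "finite {\<epsilon>. poly P \<epsilon> = 0}"
    by (rule poly_roots_finite)
  then have "\<forall>\<^sub>F \<epsilon> in at_right 0. \<forall>r\<in>{\<epsilon>. poly P \<epsilon> = 0}. \<epsilon> \<noteq> r"
    by (intro eventually_ball_finite ballI eventually_neq_at_within)
  then show ?thesis
    unfolding P by (rule eventually_mono) auto
qed

text \<open>Every point is moved by \<open>\<epsilon>\<close> times a point of the moment curve.
  Each condition of general position excludes finitely many \<open>\<epsilon>\<close>, and nonzero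
  determinants keep their sign by continuity. As there are finitely many conditions, a small
  \<open>\<epsilon>\<close> meets them all.\<close>

lemma general_position_perturbation:
  fixes p :: "nat \<Rightarrow> real^3"
  shows "\<exists>q. general_position (map q [0..<N]) \<and>
    (\<forall>a<N. \<forall>b<N. \<forall>c<N. \<forall>d<N. det3 (p b - p a) (p c - p a) (p d - p a) \<noteq> 0 \<longrightarrow>
      sgn (det3 (q b - q a) (q c - q a) (q d - q a)) = sgn (det3 (p b - p a) (p c - p a) (p d - p a)))"
proof -
  \<comment> \<open>Positive parameters, increasing with the index, so that all three coordinates of
    the moment curve increase.\<close>
  define s where "s a = real a + 1" for a
  define q where "q \<epsilon> a = p a + \<epsilon> *\<^sub>R moment_curve (s a)" for \<epsilon> a
  have q_diff: "q \<epsilon> b - q \<epsilon> a = (p b - p a) + \<epsilon> *\<^sub>R (moment_curve (s b) - moment_curve (s a))" for \<epsilon> a b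
    by (simp add: q_def algebra_simps)
  have "\<forall>\<^sub>F \<epsilon> in at_right 0. a < b \<and> b < c \<and> c < d \<longrightarrow> det3 (q \<epsilon> b - q \<epsilon> a) (q \<epsilon> c - q \<epsilon> a) (q \<epsilon> d - q \<epsilon> a) \<noteq> 0" for a b c d
  proof (cases "a < b \<and> b < c \<and> c < d")
    case True
    then have "\<forall>\<^sub>F \<epsilon> in at_right 0. det3 (q \<epsilon> b - q \<epsilon> a) (q \<epsilon> c - q \<epsilon> a) (q \<epsilon> d - q \<epsilon> a) \<noteq> 0"
      unfolding q_diff by (intro eventually_det3_perturb_nonzero) (auto simp: det3_moment_curve s_def)
    then show ?thesis
      by (rule eventually_mono) simp
  qed (rule always_eventually, blast)
  then have 1: "\<forall>\<^sub>F \<epsilon> in at_right 0. \<forall>a\<in>{..<N}. \<forall>b\<in>{..<N}. \<forall>c\<in>{..<N}. \<forall>d\<in>{..<N}.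
      a < b \<and> b < c \<and> c < d \<longrightarrow> det3 (q \<epsilon> b - q \<epsilon> a) (q \<epsilon> c - q \<epsilon> a) (q \<epsilon> d - q \<epsilon> a) \<noteq> 0"
    by (intro eventually_ball_finite ballI) auto
  have "\<forall>\<^sub>F \<epsilon> in at_right 0. a < b \<longrightarrow> q \<epsilon> a $ k \<noteq> q \<epsilon> b $ k" for a b k
  proof (cases "a < b")
    case True
    have "0 < s a" "s a < s b"
      using True by (auto simp: s_def)
    then have "s a ^ 2 < s b ^ 2" "s a ^ 3 < s b ^ 3"
      by (auto intro!: power_strict_mono)
    then have ne: "moment_curve (s b) $ k - moment_curve (s a) $ k \<noteq> 0"
      using exhaust_3[of k] \<open>s a < s b\<close> by (auto simp: moment_curve_def)
    \<comment> \<open>Both coordinates are affine in \<open>\<epsilon>\<close> with different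
      slopes, so they agree for this value only.\<close>
    have "\<forall>\<^sub>F \<epsilon> in at_right 0. \<epsilon> \<noteq> - (p b $ k - p a $ k) / (moment_curve (s b) $ k - moment_curve (s a) $ k)"
      by (rule eventually_neq_at_within)
    then show ?thesis
      by (rule eventually_mono) (use ne in \<open>auto simp: q_def field_simps\<close>)
  qed (rule always_eventually, blast)
  then have 2: "\<forall>\<^sub>F \<epsilon> in at_right 0. \<forall>k\<in>UNIV. \<forall>a\<in>{..<N}. \<forall>b\<in>{..<N}. a < b \<longrightarrow> q \<epsilon> a $ k \<noteq> q \<epsilon> b $ k"
    by (intro eventually_ball_finite ballI) auto
  have lim: "((\<lambda>\<epsilon>. (q \<epsilon> b - q \<epsilon> a) $ k) \<longlongrightarrow> (p b - p a) $ k) (at_right 0)" for a b k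
  proof -
    have "((\<lambda>\<epsilon>. (p b - p a) $ k + \<epsilon> * (moment_curve (s b) - moment_curve (s a)) $ k) \<longlongrightarrow>
        (p b - p a) $ k + 0 * (moment_curve (s b) - moment_curve (s a)) $ k) (at_right 0)"
      by (intro tendsto_intros)
    then show ?thesis
      by (simp add: q_diff)
  qed
  have "\<forall>\<^sub>F \<epsilon> in at_right 0. det3 (p b - p a) (p c - p a) (p d - p a) \<noteq> 0 \<longrightarrow>
      sgn (det3 (q \<epsilon> b - q \<epsilon> a) (q \<epsilon> c - q \<epsilon> a) (q \<epsilon> d - q \<epsilon> a)) = sgn (det3 (p b - p a) (p c - p a) (p d - p a))" for a b c d
  proof (cases "det3 (p b - p a) (p c - p a) (p d - p a) = 0")
    case False
    then have "\<forall>\<^sub>F \<epsilon> in at_right 0. sgn (det3 (q \<epsilon> b - q \<epsilon> a) (q \<epsilon> c - q \<epsilon> a) (q \<epsilon> d - q \<epsilon> a)) = sgn (det3 (p b - p a) (p c - p a) (p d - p a))"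
      by (intro eventually_sgn_eq_limit tendsto_det3 lim)
    then show ?thesis
      by (rule eventually_mono) simp
  qed (rule always_eventually, blast)
  then have 3: "\<forall>\<^sub>F \<epsilon> in at_right 0. \<forall>a\<in>{..<N}. \<forall>b\<in>{..<N}. \<forall>c\<in>{..<N}. \<forall>d\<in>{..<N}. det3 (p b - p a) (p c - p a) (p d - p a) \<noteq> 0 \<longrightarrow>
      sgn (det3 (q \<epsilon> b - q \<epsilon> a) (q \<epsilon> c - q \<epsilon> a) (q \<epsilon> d - q \<epsilon> a)) = sgn (det3 (p b - p a) (p c - p a) (p d - p a))"
    by (intro eventually_ball_finite ballI) auto
  obtain \<epsilon> where e1: "\<forall>a\<in>{..<N}. \<forall>b\<in>{..<N}. \<forall>c\<in>{..<N}. \<forall>d\<in>{..<N}.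
      a < b \<and> b < c \<and> c < d \<longrightarrow> det3 (q \<epsilon> b - q \<epsilon> a) (q \<epsilon> c - q \<epsilon> a) (q \<epsilon> d - q \<epsilon> a) \<noteq> 0"
    and e2: "\<forall>k\<in>UNIV. \<forall>a\<in>{..<N}. \<forall>b\<in>{..<N}. a < b \<longrightarrow> q \<epsilon> a $ k \<noteq> q \<epsilon> b $ k"
    and e3: "\<forall>a\<in>{..<N}. \<forall>b\<in>{..<N}. \<forall>c\<in>{..<N}. \<forall>d\<in>{..<N}. det3 (p b - p a) (p c - p a) (p d - p a) \<noteq> 0 \<longrightarrow>
      sgn (det3 (q \<epsilon> b - q \<epsilon> a) (q \<epsilon> c - q \<epsilon> a) (q \<epsilon> d - q \<epsilon> a)) = sgn (det3 (p b - p a) (p c - p a) (p d - p a))"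
    using eventually_happens'[OF trivial_limit_at_right_real eventually_conj[OF 1 eventually_conj[OF 2 3]]]
    by (elim exE conjE) (rule that)
  have "general_position (map (q \<epsilon>) [0..<N])"
    unfolding general_position_def coplanar_iff_det3
  proof (intro conjI allI impI)
    fix i j k l assume h: "i < j \<and> j < k \<and> k < l \<and> l < length (map (q \<epsilon>) [0..<N])"
    then have "det3 (q \<epsilon> j - q \<epsilon> i) (q \<epsilon> k - q \<epsilon> i) (q \<epsilon> l - q \<epsilon> i) \<noteq> 0"
      by (intro e1[rule_format]) auto
    then show "det3 (map (q \<epsilon>) [0..<N] ! j - map (q \<epsilon>) [0..<N] ! i) (map (q \<epsilon>) [0..<N] ! k - map (q \<epsilon>) [0..<N] ! i)
        (map (q \<epsilon>) [0..<N] ! l - map (q \<epsilon>) [0..<N] ! i) \<noteq> 0"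
      using h by simp
  next
    fix k i j assume h: "i < j \<and> j < length (map (q \<epsilon>) [0..<N])"
    then have "q \<epsilon> i $ k \<noteq> q \<epsilon> j $ k"
      by (intro e2[rule_format]) auto
    then show "map (q \<epsilon>) [0..<N] ! i $ k \<noteq> map (q \<epsilon>) [0..<N] ! j $ k"
      using h by simp
  qed
  moreover have "\<forall>a<N. \<forall>b<N. \<forall>c<N. \<forall>d<N. det3 (p b - p a) (p c - p a) (p d - p a) \<noteq> 0 \<longrightarrow>
      sgn (det3 (q \<epsilon> b - q \<epsilon> a) (q \<epsilon> c - q \<epsilon> a) (q \<epsilon> d - q \<epsilon> a)) = sgn (det3 (p b - p a) (p c - p a) (p d - p a))"
    by (intro allI impI e3[rule_format]) auto
  ultimately show ?thesis
    by (intro exI[of _ "q \<epsilon>"] conjI)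
qed

text \<open>The planar configuration provides \<open>2 ^ K\<close> levels, and the lifted one has a
  point for each set of levels. The levels extracted from a homogeneous subsequence form a cup or a
  cap, so there are at most \<open>K + 1\<close> of them, whence \<open>4 * (K + 1) + 2\<close>
  points.\<close>

lemma large_configuration:
  "\<exists>ps. length ps = 2 ^ 2 ^ K \<and> general_position ps \<and>
     (\<forall>qs. subseq qs ps \<and> order_type_homogeneous qs \<longrightarrow> length qs \<le> 4 * K + 6)"
proof -
  define M :: nat where "M = 2 ^ K"
  obtain Y Z :: "nat \<Rightarrow> real" where mono: "\<forall>a<2 ^ K. \<forall>b<2 ^ K. a < b \<longrightarrow> Y a < Y b"
    and sgn: "\<forall>a<2 ^ K. \<forall>b<2 ^ K. \<forall>c<2 ^ K. a < b \<and> b < c \<longrightarrow>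
        sgn (det2 Y Z a b c) = sgn (real (top_bit b c) - real (top_bit a b))"
    using planar_configuration[of K] by (elim exE conjE) (rule that)
  have nz_sorted: "det2 Y Z i j l \<noteq> 0" if "i < j" "j < l" "l < M" for i j l
  proof -
    have "sgn (det2 Y Z i j l) = sgn (real (top_bit j l) - real (top_bit i j))"
      using sgn that by (auto simp: M_def)
    then show ?thesis
      using top_bit_neq[OF that(1,2)] by (auto simp: sgn_if split: if_splits)
  qed
  \<comment> \<open>\<open>det2\<close> is alternating, so all six orders reduce to the sorted
    one.\<close>
  have nz: "det2 Y Z i j l \<noteq> 0" if neq: "i < M" "j < M" "l < M" "i \<noteq> j" "j \<noteq> l" "i \<noteq> l" for i j l
  proof -
    consider "i < j" "j < l" | "i < l" "l < j" | "j < i" "i < l" | "j < l" "l < i" | "l < i" "i < j" | "l < j" "j < i"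
      using neq by (meson linorder_less_linear)
    moreover have "det2 Y Z i l j = - det2 Y Z i j l" "det2 Y Z j i l = - det2 Y Z i j l"
      "det2 Y Z j l i = det2 Y Z i j l" "det2 Y Z l i j = det2 Y Z i j l" "det2 Y Z l j i = - det2 Y Z i j l"
      by (simp_all add: det2_def algebra_simps)
    ultimately show ?thesis
    proof (cases, goal_cases)
      case 1 then show ?thesis using nz_sorted[of i j l] neq by simp
    next
      case 2 then show ?thesis using nz_sorted[of i l j] neq by simp
    next
      case 3 then show ?thesis using nz_sorted[of j i l] neq by simp
    next
      case 4 then show ?thesis using nz_sorted[of j l i] neq by simp
    next
      case 5 then show ?thesis using nz_sorted[of l i j] neq by simp
    next
      case 6 then show ?thesis using nz_sorted[of l j i] neq by simp
    qed
  qed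
  then have "\<forall>i<M. \<forall>j<M. \<forall>l<M. i \<noteq> j \<longrightarrow> j \<noteq> l \<longrightarrow> i \<noteq> l \<longrightarrow> det2 Y Z i j l \<noteq> 0"
    by simp
  from lifted_configuration[OF this] obtain p where p: "\<forall>a<2 ^ M. \<forall>b<2 ^ M. \<forall>c<2 ^ M. \<forall>d<2 ^ M. a < b \<and> b < c \<and> c < d \<and> top_bit a b \<noteq> top_bit c d \<longrightarrow>
    sgn (det3 (p b - p a) (p c - p a) (p d - p a)) = sgn (det2 Y Z (top_bit a b) (top_bit b c) (top_bit c d))
    \<and> det3 (p b - p a) (p c - p a) (p d - p a) \<noteq> 0"
    by (elim exE) (rule that)
  obtain q where gp: "general_position (map q [0..<2 ^ M])"
    and q: "\<forall>a<2 ^ M. \<forall>b<2 ^ M. \<forall>c<2 ^ M. \<forall>d<2 ^ M. det3 (p b - p a) (p c - p a) (p d - p a) \<noteq> 0 \<longrightarrow>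
      sgn (det3 (q b - q a) (q c - q a) (q d - q a)) = sgn (det3 (p b - p a) (p c - p a) (p d - p a))"
    using general_position_perturbation[of "2 ^ M" p] by (elim exE conjE) (rule that)
  define ps where "ps = map q [0..<2 ^ M]"
  have "length qs \<le> 4 * K + 6" if qs: "subseq qs ps" "order_type_homogeneous qs" for qs
  proof -
    obtain ix where ix: "sorted_wrt (<) ix" "set ix \<subseteq> {..<length ps}" "qs = map ((!) ps) ix"
      using subseq_imp_map_nth[OF qs(1)] by blast
    obtain \<sigma> where \<sigma>: "\<And>i j k l. i < j \<and> j < k \<and> k < l \<and> l < length qs \<Longrightarrow>
        orientation (qs ! i) (qs ! j) (qs ! k) (qs ! l) = \<sigma>"
      using qs(2) unfolding order_type_homogeneous_def by blast
    define S where "S = set ix"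
    have S: "finite S" "S \<subseteq> {..<2 ^ M}" "card S = length qs"
      using ix by (auto simp: S_def ps_def distinct_card strict_sorted_iff)
    have nth: "qs ! i = q (ix ! i)" if "i < length ix" for i
    proof -
      have "ix ! i \<in> {..<2 ^ M}"
        using nth_mem[OF that] S(2) unfolding S_def by (rule subsetD[rotated])
      then show ?thesis
        using that by (simp add: ix(3) ps_def)
    qed
    have index_less: "i < j" if "ix ! i < ix ! j" "i < length ix" for i j
      using that ix(1) by (metis not_less_iff_gr_or_eq order_less_imp_not_less sorted_wrt_iff_nth_less)
    have "homogeneous4 (\<lambda>i j l. sgn (det2 Y Z i j l)) \<sigma> S"
      unfolding homogeneous4_def
    proof (intro ballI impI)
      fix a b c d assume mem: "a \<in> S" "b \<in> S" "c \<in> S" "d \<in> S"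
        and h: "a < b \<and> b < c \<and> c < d \<and> top_bit a b \<noteq> top_bit c d"
      obtain i j k l where ijkl: "ix ! i = a" "ix ! j = b" "ix ! k = c" "ix ! l = d"
        and len: "i < length ix" "j < length ix" "k < length ix" "l < length ix"
        using mem unfolding S_def in_set_conv_nth by blast
      have "i < j \<and> j < k \<and> k < l \<and> l < length qs"
        using h ijkl len index_less by (auto simp: ix(3))
      then have "orientation (q a) (q b) (q c) (q d) = \<sigma>"
        using \<sigma>[of i j k l] nth len ijkl by simp
      moreover have lt: "a < 2 ^ M" "b < 2 ^ M" "c < 2 ^ M" "d < 2 ^ M"
        using mem S(2) by auto
      \<comment> \<open>The determinant for \<open>p\<close> has the prescribed sign and is nonzero,
        so \<open>q\<close> inherits that sign.\<close>
      moreover note p[rule_format, OF lt h] q[rule_format, OF lt]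
      ultimately show "sgn (det2 Y Z (top_bit a b) (top_bit b c) (top_bit c d)) = \<sigma>"
        unfolding orientation_eq_sgn_det3 by simp
    qed
    then have "\<exists>A\<subseteq>{..<M}. card S \<le> 4 * card A + 2 \<and>
        (\<exists>s. \<forall>i\<in>A. \<forall>j\<in>A. \<forall>l\<in>A. i < j \<and> j < l \<longrightarrow> sgn (det2 Y Z i j l) = s)"
    proof (rule homogeneous_levels[rotated -1])
      show "Y i < Y j" if "i < j" "j < M" for i j
        using mono that by (auto simp: M_def)
      show "S \<subseteq> {a. a div 2 ^ M = 0}"
        using S(2) by auto
    qed (use nz S(1) in auto)
    then obtain A s where A: "A \<subseteq> {..<M}" "card S \<le> 4 * card A + 2"
      and s: "\<forall>i\<in>A. \<forall>j\<in>A. \<forall>l\<in>A. i < j \<and> j < l \<longrightarrow> sgn (det2 Y Z i j l) = s"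
      by (elim exE conjE) (rule that)
    have "card A \<le> K + 1"
    proof (rule cups_caps_bound)
      show "A \<subseteq> {..<2 ^ K}"
        using A(1) by (simp add: M_def)
      show "sgn (real (top_bit b c) - real (top_bit a b)) = s"
        if abc: "a \<in> A" "b \<in> A" "c \<in> A" "a < b" "b < c" for a b c
      proof -
        have "a < 2 ^ K" "b < 2 ^ K" "c < 2 ^ K"
          using abc A(1) by (auto simp: M_def)
        then show ?thesis
          using s sgn abc by metis
      qed
    qed
    then show ?thesis
      using A(2) S(3) by simp
  qed
  then show ?thesis
    using gp by (intro exI[of _ ps]) (auto simp: ps_def M_def)
qed

section \<open>From configurations to bounds on \<open>OT3\<close>\<close>

lemma OT3_bound_OT3: "OT3_bound n (OT3 n)"
  unfolding OT3_def by (rule LeastI_ex) (rule OT3_bound_exists)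

text \<open>\<open>OT3_bound\<close> speaks of sequences of one exact length; a longer sequence is
  cut to a prefix, which stays in general position.\<close>

lemma OT3_subseq:
  assumes "general_position ps" "OT3 n \<le> length ps"
  shows "\<exists>qs. subseq qs (take (OT3 n) ps) \<and> length qs = n \<and> order_type_homogeneous qs"
proof -
  have "general_position (take (OT3 n) ps)"
    using assms(1) by (rule general_position_subseq[rotated]) (simp add: prefix_imp_subseq take_is_prefix)
  then show ?thesis
    using OT3_bound_OT3[of n] assms(2) unfolding OT3_bound_def by simp
qed

text \<open>A prefix of a large configuration shows that there are sequences of length
  \<open>OT3 n\<close> in general position, so \<open>OT3_bound\<close> does not hold vacuously. For
  \<open>n \<ge> 3\<close> this keeps the double logarithm positive.\<close>

lemma OT3_ge: "n \<le> OT3 n"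
proof (rule ccontr)
  assume "\<not> n \<le> OT3 n"
  obtain ps where ps: "length ps = 2 ^ 2 ^ n" "general_position ps"
    using large_configuration[of n] by blast
  have "n < 2 ^ n" "(2::nat) ^ n < 2 ^ 2 ^ n"
    by (rule less_exp)+
  then have "OT3 n \<le> length ps"
    using ps(1) \<open>\<not> n \<le> OT3 n\<close> by linarith
  then obtain qs where "subseq qs (take (OT3 n) ps)" "length qs = n"
    using OT3_subseq[OF ps(2)] by blast
  then have "n \<le> length (take (OT3 n) ps)"
    using list_emb_length by blast
  then show False
    using \<open>\<not> n \<le> OT3 n\<close> by simp
qed

text \<open>A large configuration has no homogeneous subsequence of \<open>n\<close> points, so it
  must be shorter than \<open>OT3 n\<close>.\<close>

lemma OT3_gt_double_exp:
  assumes "4 * K + 6 < n"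
  shows "2 ^ 2 ^ K < OT3 n"
proof (rule ccontr)
  assume "\<not> 2 ^ 2 ^ K < OT3 n"
  obtain ps where ps: "length ps = 2 ^ 2 ^ K" "general_position ps"
    "\<And>qs. subseq qs ps \<Longrightarrow> order_type_homogeneous qs \<Longrightarrow> length qs \<le> 4 * K + 6"
    using large_configuration[of K] by blast
  then obtain qs where qs: "subseq qs (take (OT3 n) ps)" "length qs = n" "order_type_homogeneous qs"
    using OT3_subseq[OF ps(2), of n] \<open>\<not> _\<close> by auto
  have "subseq qs ps"
    using qs(1) by (rule subseq_order.trans) (simp add: prefix_imp_subseq take_is_prefix)
  then show False
    using ps(3) qs assms by fastforce
qed

theorem corollary1p4:
  shows "\<exists>f :: nat \<Rightarrow> real. is_big_Theta f (\<lambda>n. real n) \<and>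
           (\<forall>n\<ge>3. real (OT3 n) = 2 powr (2 powr f n))"
proof -
  \<comment> \<open>The equation is claimed from \<open>n = 3\<close> on; the value \<open>n\<close>
    below that satisfies both linear bounds at once.\<close>
  define f where "f n = (if n < 3 then real n else log 2 (log 2 (real (OT3 n))))" for n
  \<comment> \<open>A positive lower bound for \<open>f\<close> on all \<open>n \<ge> 3\<close>,
    since there \<open>OT3 n \<ge> 3\<close>.\<close>
  define c where "c = log 2 (log 2 (3::real))"
  have "log 2 (2::real) < log 2 3"
    by (subst log_less_cancel_iff) auto
  then have log3: "log 2 (3::real) > 1"
    by simp
  then have "log 2 (1::real) < c"
    unfolding c_def by (subst log_less_cancel_iff) auto
  then have c: "c > 0"
    by simp
  have OT3: "real (OT3 n) \<ge> 3" "log 2 (real (OT3 n)) > 1" "f n \<ge> c" if "n \<ge> 3" for n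
  proof -
    show 1: "real (OT3 n) \<ge> 3"
      using OT3_ge[of n] that by linarith
    then have 2: "log 2 3 \<le> log 2 (real (OT3 n))"
      by (subst log_le_cancel_iff) auto
    then show "log 2 (real (OT3 n)) > 1"
      using log3 by linarith
    have "log 2 (log 2 3) \<le> log 2 (log 2 (real (OT3 n)))"
      using 2 log3 by (subst log_le_cancel_iff) linarith+
    then show "f n \<ge> c"
      using that by (simp add: f_def c_def)
  qed
  have eq: "real (OT3 n) = 2 powr (2 powr f n)" if "n \<ge> 3" for n
    using OT3(1,2)[OF that] that by (simp add: f_def)
  have upper: "\<bar>f n\<bar> \<le> 24 * \<bar>real n\<bar>" if "n \<ge> 1" for n
  proof (cases "n < 3")
    case False
    then have "2 powr (2 powr f n) \<le> 2 powr (2 powr (24 * real n))"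
      using log_log_OT3_upper[of n] eq[of n] by simp
    then have "f n \<le> 24 * real n"
      by simp
    then show ?thesis
      using OT3(3)[of n] c False by simp
  qed (simp add: f_def)
  \<comment> \<open>The summand 8 serves the range \<open>n \<ge> 28\<close>, where
    \<open>n \<le> 8 * K\<close>. The summand \<open>28 / c\<close> serves
    \<open>3 \<le> n < 28\<close>, where only \<open>f n \<ge> c\<close> is known.\<close>
  define C where "C = 8 + 28 / c"
  have C: "C \<ge> 8" "C * c \<ge> 28"
    using c by (auto simp: C_def field_simps)
  have lower: "\<bar>real n\<bar> \<le> C * \<bar>f n\<bar>" if "n \<ge> 1" for n
  proof -
    consider "n < 3" | "3 \<le> n" "n < 28" | "28 \<le> n" by linarith
    then show ?thesis
    proof cases
      case 1
      then show ?thesis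
        using C(1) mult_right_mono[of 1 C "real n"] by (simp add: f_def)
    next
      case 2
      have "real n \<le> C * c"
        using 2 C(2) by linarith
      also have "\<dots> \<le> C * f n"
        using OT3(3)[OF 2(1)] C(1) by (intro mult_left_mono) auto
      finally show ?thesis
        using OT3(3)[OF 2(1)] c by simp
    next
      case 3
      \<comment> \<open>The largest \<open>K\<close> with \<open>4 * K + 6 < n\<close>.\<close>
      define K where "K = (n - 7) div 4"
      have K: "4 * K + 6 < n" "n \<le> 8 * K"
        using 3 by (auto simp: K_def)
      have "real (2 ^ 2 ^ K) \<le> real (OT3 n)"
        using OT3_gt_double_exp[OF K(1)] by (intro of_nat_mono) simp
      then have "2 powr (2 powr real K) \<le> 2 powr (2 powr f n)"
        using eq[of n] 3 by (simp add: powr_realpow[symmetric])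
      then have "real K \<le> f n"
        by simp
      then have "real n \<le> 8 * f n"
        using K(2) by linarith
      also have "\<dots> \<le> C * f n"
        using C(1) OT3(3)[of n] 3 c by (intro mult_right_mono) auto
      finally show ?thesis
        using OT3(3)[of n] 3 c by simp
    qed
  qed
  show ?thesis
    unfolding is_big_Theta_def is_big_Omega_def is_big_O_def
    using upper lower eq by blast
qed

end
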